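(* Let $\mathcal L_0$ be the generator on $L^2(\pi)$ of an ergodic time-reversible Markov process with invariant probability measure $\pi$ and a spectral gap, let $\mathcal S$ be a reversible perturbation and $\mathcal A$ an irreversible perturbation (as defined in the context), and let $\mathcal L=\mathcal L_0+\mathcal S+\mathcal A$. Assume that the operator $(-\mathcal L_0-\mathcal S)^{-1/2}\,\mathcal A\,(-\mathcal L_0-\mathcal S)^{-1/2}$ is bounded (on the space $H^0_{\mathbb R}$ of mean-zero functions). Then for every $f\in L^2_{\mathbb R}(\pi)$ the asymptotic variance $\sigma^2(f)$ for the process with generator $\mathcal L$ and the asymptotic variance $\sigma_0^2(f)$ for the process with generator $\mathcal L_0$ satisfy $$\sigma^2(f)\le\sigma_0^2(f).$$
   Context: Reference process. $X_0(t)$ is an ergodic time-reversible continuous-time Markov process on a state space $E$ with invariant probability measure $\pi$. $L^2_{\mathbb R}(\pi)$ is the real Hilbert space with scalar product $\langle f,g\rangle=\int f g\,d\pi$. The semigroup of $X_0$ is strongly continuous on $L^2_{\mathbb R}(\pi)$ with self-adjoint generator $\mathcal L_0$ of domain $D(\mathcal L_0)$, and it has a spectral gap: there is $\lambda_0<0$ with $\sigma(\mathcal L_0)\setminus\{0\}\subset(-\infty,\lambda_0]$; in particular $\langle f,\mathcal L_0 f\rangle\le 0$. Reversible perturbation $\mathcal S$: $D(\mathcal L_0)\subset D(\mathcal S)$; $\mathcal L_0+\mathcal S$ is the (self-adjoint) generator of a Markov process with invariant measure $\pi$; $\mathcal S$ is self-adjoint, $\langle f,\mathcal S g\rangle=\langle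 \mathcal S f,g\rangle$ for $f,g\in D(\mathcal S)$; and $\langle f,\mathcal S f\rangle\le 0$ for all $f\in D(\mathcal S)$. Irreversible perturbation $\mathcal A$: $D(\mathcal L_0+\mathcal S)\subset D(\mathcal A)$; $\mathcal L=\mathcal L_0+\mathcal S+\mathcal A$ is the generator of a Markov process $X(t)$ with invariant measure $\pi$ and semigroup $T_t$; and $\langle f,\mathcal A g\rangle=-\langle\mathcal A f,g\rangle$ for $f,g\in D(\mathcal A)$. $H^0_{\mathbb R}=\{f\in L^2_{\mathbb R}(\pi):\int f\,d\pi=0\}$. It is assumed that $\mathcal L_0$ and $\mathcal L$ restricted to $H^0_{\mathbb R}$ are invertible, with bounded inverses $\mathcal L_0^{-1},\mathcal L^{-1}$ on $H^0_{\mathbb R}$. Asymptotic variance. For $f\in L^2_{\mathbb R}(\pi)$ put $\bar f=\int f\,d\pi$ and $S_t(f)=\int_0^t f(X(s))\,ds$. Then $$\sigma^2(f)=\lim_{t\to\infty}\frac1t\operatorname{Var}_\pi(S_t(f))=2\int_0^\infty\langle T_t(f-\bar f),f-\bar f\rangle\,dt=2\,\langle f-\bar f,(-\mathcal L)^{-1}(f-\bar f)\rangle ,$$ and $\sigma_0^2(f)$ is the same quantity for $X_0$, i.e. with $\mathcal L_0$ in place of $\mathcal L$. *)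

theory Defs
  imports "HOL-Probability.Probability"
begin

section \<open>The real Hilbert space of square-integrable functions\<close>

text \<open>
  Elements of the space are represented by measurable square-integrable functions; identity of
  elements is almost-everywhere equality.
\<close>

definition L2 :: "'e measure \<Rightarrow> ('e \<Rightarrow> real) set" where
  "L2 M = {f \<in> borel_measurable M. integrable M (\<lambda>x. (f x)\<^sup>2)}"

definition l2_inner :: "'e measure \<Rightarrow> ('e \<Rightarrow> real) \<Rightarrow> ('e \<Rightarrow> real) \<Rightarrow> real" where
  "l2_inner M f g = (\<integral>x. f x * g x \<partial>M)"

definition l2_norm :: "'e measure \<Rightarrow> ('e \<Rightarrow> real) \<Rightarrow> real" where
  "l2_norm M f = sqrt (l2_inner M f f)"

definition mean_zero :: "'e measure \<Rightarrow> ('e \<Rightarrow> real) set" where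
  "mean_zero M = {f \<in> L2 M. (\<integral>x. f x \<partial>M) = 0}"


section \<open>Unbounded operators\<close>

text \<open>
  An operator is given by its graph, so its domain is \<^const>\<open>Domain\<close>, its inverse is the converse
  relation, and \<open>T O U\<close> is ``first \<open>T\<close>, then \<open>U\<close>'' on the maximal domain. A graph is required to be
  closed under changing either component on a null set, and to be single-valued up to null sets.
  The parameter \<open>V\<close> is the ambient Hilbert space.
\<close>

type_synonym 'e l2_op = "(('e \<Rightarrow> real) \<times> ('e \<Rightarrow> real)) set"

definition linear_operator :: "'e measure \<Rightarrow> ('e \<Rightarrow> real) set \<Rightarrow> 'e l2_op \<Rightarrow> bool" where
  "linear_operator M V T \<longleftrightarrow>
     T \<subseteq> V \<times> V \<and>
     ((\<lambda>x. 0), (\<lambda>x. 0)) \<in> T \<and>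
     (\<forall>f g f' g'. (f, g) \<in> T \<and> (f', g') \<in> T \<longrightarrow> ((\<lambda>x. f x + f' x), (\<lambda>x. g x + g' x)) \<in> T) \<and>
     (\<forall>c f g. (f, g) \<in> T \<longrightarrow> ((\<lambda>x. c * f x), (\<lambda>x. c * g x)) \<in> T) \<and>
     (\<forall>f g. \<forall>f'\<in>V. \<forall>g'\<in>V. (f, g) \<in> T \<and> (AE x in M. f x = f' x) \<and> (AE x in M. g x = g' x)
        \<longrightarrow> (f', g') \<in> T) \<and>
     (\<forall>f g g'. (f, g) \<in> T \<and> (f, g') \<in> T \<longrightarrow> (AE x in M. g x = g' x))"

definition op_sum :: "'e l2_op \<Rightarrow> 'e l2_op \<Rightarrow> 'e l2_op" where
  "op_sum T U = {(f, \<lambda>x. g x + h x) | f g h. (f, g) \<in> T \<and> (f, h) \<in> U}"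

definition op_neg :: "'e l2_op \<Rightarrow> 'e l2_op" where
  "op_neg T = {(f, \<lambda>x. - g x) | f g. (f, g) \<in> T}"

text \<open>\<open>T - c\<close>, for a scalar \<open>c\<close>\<close>

definition op_shift :: "'e l2_op \<Rightarrow> real \<Rightarrow> 'e l2_op" where
  "op_shift T c = {(f, \<lambda>x. g x - c * f x) | f g. (f, g) \<in> T}"

text \<open>For an operator that maps its domain within \<open>V\<close> into \<open>V\<close>, this is its restriction to \<open>V\<close>.\<close>

definition op_restrict :: "('e \<Rightarrow> real) set \<Rightarrow> 'e l2_op \<Rightarrow> 'e l2_op" where
  "op_restrict V T = T \<inter> V \<times> V"

text \<open>Boundedness on the domain of the operator, which need not be all of the ambient space.\<close>

definition op_bounded :: "'e measure \<Rightarrow> 'e l2_op \<Rightarrow> bool" where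
  "op_bounded M T \<longleftrightarrow> (\<exists>C. \<forall>(f, g)\<in>T. l2_norm M g \<le> C * l2_norm M f)"

text \<open>
  The operator \<open>T\<close> in \<open>V\<close> is onto \<open>V\<close> with bounded inverse; injectivity up to null sets is
  contained in the boundedness of the converse relation.
\<close>

definition boundedly_invertible :: "'e measure \<Rightarrow> ('e \<Rightarrow> real) set \<Rightarrow> 'e l2_op \<Rightarrow> bool" where
  "boundedly_invertible M V T \<longleftrightarrow> Range T = V \<and> op_bounded M (T\<inverse>)"

text \<open>
  Only real spectral values are considered; for the self-adjoint operators to which this is
  applied, the spectrum of the complexification is real.
\<close>

definition op_spectrum :: "'e measure \<Rightarrow> ('e \<Rightarrow> real) set \<Rightarrow> 'e l2_op \<Rightarrow> real set" where
  "op_spectrum M V T = {c. \<not> boundedly_invertible M V (op_shift T c)}"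

definition op_adjoint :: "'e measure \<Rightarrow> ('e \<Rightarrow> real) set \<Rightarrow> 'e l2_op \<Rightarrow> 'e l2_op" where
  "op_adjoint M V T =
     {(u, v). u \<in> V \<and> v \<in> V \<and> (\<forall>(f, g)\<in>T. l2_inner M g u = l2_inner M f v)}"

text \<open>
  Density of the domain is implied: if \<open>v\<close> is orthogonal to the domain of \<open>T\<close>, then \<open>(0, v)\<close> belongs
  to the adjoint relation, hence to \<open>T\<close>, hence \<open>v = 0\<close> almost everywhere.
\<close>

definition self_adjoint :: "'e measure \<Rightarrow> ('e \<Rightarrow> real) set \<Rightarrow> 'e l2_op \<Rightarrow> bool" where
  "self_adjoint M V T \<longleftrightarrow> linear_operator M V T \<and> op_adjoint M V T = T"

text \<open>The unique positive self-adjoint square root of a positive self-adjoint operator in \<open>V\<close>\<close>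

definition op_sqrt :: "'e measure \<Rightarrow> ('e \<Rightarrow> real) set \<Rightarrow> 'e l2_op \<Rightarrow> 'e l2_op" where
  "op_sqrt M V T =
     (THE Q. self_adjoint M V Q \<and> (\<forall>(f, g)\<in>Q. 0 \<le> l2_inner M f g) \<and> Q O Q = T)"

definition op_inv_sqrt :: "'e measure \<Rightarrow> ('e \<Rightarrow> real) set \<Rightarrow> 'e l2_op \<Rightarrow> 'e l2_op" where
  "op_inv_sqrt M V T = (op_sqrt M V T)\<inverse>"


section \<open>Markov semigroups and processes\<close>

text \<open>
  \<open>P t x\<close> is the law at time \<open>t \<ge> 0\<close> of the process started at \<open>x\<close>. The state space and its
  sigma-algebra are those of the probability measure \<open>M\<close>.
\<close>

definition transition_semigroup :: "'e measure \<Rightarrow> (real \<Rightarrow> 'e \<Rightarrow> 'e measure) \<Rightarrow> bool" where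
  "transition_semigroup M P \<longleftrightarrow>
     (\<forall>t\<ge>0. P t \<in> measurable M (prob_algebra M)) \<and>
     (\<forall>x\<in>space M. P 0 x = return M x) \<and>
     (\<forall>s\<ge>0. \<forall>t\<ge>0. \<forall>x\<in>space M. P (s + t) x = bind (P s x) (P t))"

definition invariant :: "'e measure \<Rightarrow> (real \<Rightarrow> 'e \<Rightarrow> 'e measure) \<Rightarrow> bool" where
  "invariant M P \<longleftrightarrow> (\<forall>t\<ge>0. bind M (P t) = M)"

definition ergodic :: "'e measure \<Rightarrow> (real \<Rightarrow> 'e \<Rightarrow> 'e measure) \<Rightarrow> bool" where
  "ergodic M P \<longleftrightarrow>
     (\<forall>B\<in>sets M. (\<forall>t\<ge>0. AE x in M. measure (P t x) B = indicator B x)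
        \<longrightarrow> measure M B = 0 \<or> measure M B = 1)"

definition time_reversible :: "'e measure \<Rightarrow> (real \<Rightarrow> 'e \<Rightarrow> 'e measure) \<Rightarrow> bool" where
  "time_reversible M P \<longleftrightarrow>
     (\<forall>t\<ge>0. \<forall>B\<in>sets M. \<forall>C\<in>sets M.
        (LINT x:B|M. measure (P t x) C) = (LINT x:C|M. measure (P t x) B))"

definition semigroup_op ::
    "(real \<Rightarrow> 'e \<Rightarrow> 'e measure) \<Rightarrow> real \<Rightarrow> ('e \<Rightarrow> real) \<Rightarrow> 'e \<Rightarrow> real" where
  "semigroup_op P t f = (\<lambda>x. \<integral>y. f y \<partial>P t x)"

definition strongly_continuous :: "'e measure \<Rightarrow> (real \<Rightarrow> 'e \<Rightarrow> 'e measure) \<Rightarrow> bool" where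
  "strongly_continuous M P \<longleftrightarrow>
     (\<forall>f\<in>L2 M. ((\<lambda>t. l2_norm M (\<lambda>x. semigroup_op P t f x - f x)) \<longlongrightarrow> 0) (at_right 0))"

definition generator :: "'e measure \<Rightarrow> (real \<Rightarrow> 'e \<Rightarrow> 'e measure) \<Rightarrow> 'e l2_op" where
  "generator M P =
     {(f, g). f \<in> L2 M \<and> g \<in> L2 M \<and>
        ((\<lambda>t. l2_norm M (\<lambda>x. (semigroup_op P t f x - f x) / t - g x)) \<longlongrightarrow> 0) (at_right 0)}"

definition natural_filtration ::
    "'e measure \<Rightarrow> 'w measure \<Rightarrow> (real \<Rightarrow> 'w \<Rightarrow> 'e) \<Rightarrow> real \<Rightarrow> 'w measure" where
  "natural_filtration M W X s =
     sigma (space W) {X u -` B \<inter> space W | u B. 0 \<le> u \<and> u \<le> s \<and> B \<in> sets M}"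

text \<open>
  A Markov process with transition semigroup \<open>P\<close> whose initial law is the invariant measure \<open>M\<close>.
  Joint measurability makes the time integrals of the process below well defined.
\<close>

definition stationary_markov_process ::
    "'e measure \<Rightarrow> (real \<Rightarrow> 'e \<Rightarrow> 'e measure) \<Rightarrow> 'w measure \<Rightarrow> (real \<Rightarrow> 'w \<Rightarrow> 'e) \<Rightarrow> bool" where
  "stationary_markov_process M P W X \<longleftrightarrow>
     transition_semigroup M P \<and> invariant M P \<and> strongly_continuous M P \<and>
     prob_space W \<and>
     (\<lambda>(t, w). X t w) \<in> measurable (restrict_space borel {0..} \<Otimes>\<^sub>M W) M \<and>
     distr W M (X 0) = M \<and>
     (\<forall>s\<ge>0. \<forall>t\<ge>0. \<forall>B\<in>sets M. AE w in W.
        real_cond_exp W (natural_filtration M W X s) (indicator (X (s + t) -` B \<inter> space W)) w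
          = measure (P t (X s w)) B)"


section \<open>Asymptotic variance\<close>

definition time_integral :: "(real \<Rightarrow> 'w \<Rightarrow> 'e) \<Rightarrow> ('e \<Rightarrow> real) \<Rightarrow> real \<Rightarrow> 'w \<Rightarrow> real" where
  "time_integral X f t w = (LINT s:{0..t}|lborel. f (X s w))"

definition has_asymptotic_variance ::
    "'w measure \<Rightarrow> (real \<Rightarrow> 'w \<Rightarrow> 'e) \<Rightarrow> ('e \<Rightarrow> real) \<Rightarrow> real \<Rightarrow> bool" where
  "has_asymptotic_variance W X f v \<longleftrightarrow>
     ((\<lambda>t. prob_space.variance W (time_integral X f t) / t) \<longlongrightarrow> v) at_top"

end

theory Submission
  imports Defs
begin

text \<open>
  Let \<open>h = f - \<integral>f d\<pi>\<close>. If \<open>-L u = h\<close> and \<open>-L w = u\<close>, then \<open>t \<mapsto> \<langle>h, u - T\<^sub>t u\<rangle>\<close> is an antiderivative of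
  the covariance \<open>\<langle>h, T\<^sub>t h\<rangle>\<close>, and \<open>D t = t \<langle>h, u\<rangle> - \<langle>h, w - T\<^sub>t w\<rangle>\<close> is an antiderivative of that. Hence the
  variance of the time integral up to \<open>t\<close> is exactly \<open>2 D t\<close>; since \<open>T\<^sub>t\<close> contracts, dividing by \<open>t\<close> gives the
  limit \<open>2 \<langle>h, u\<rangle>\<close>.

  For the comparison let \<open>-L\<^sub>0 u\<^sub>0 = h\<close>. As \<open>\<langle>u, A u\<rangle> = 0\<close> and \<open>S \<le> 0\<close>, we get \<open>\<langle>u, -L\<^sub>0 u\<rangle> \<le> \<langle>h, u\<rangle>\<close>, and
  expanding \<open>\<langle>u - u\<^sub>0, -L\<^sub>0 (u - u\<^sub>0)\<rangle> \<ge> 0\<close> yields \<open>\<langle>h, u\<rangle> \<le> \<langle>h, u\<^sub>0\<rangle>\<close>.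
\<close>

section \<open>The space of square-integrable functions\<close>

lemma L2_measurable [measurable_dest]: "f \<in> L2 M \<Longrightarrow> f \<in> borel_measurable M"
  by (simp add: L2_def)

lemma L2_integrable_square: "f \<in> L2 M \<Longrightarrow> integrable M (\<lambda>x. (f x)\<^sup>2)"
  by (simp add: L2_def)

lemma L2_integrable_mult:
  assumes "f \<in> L2 M" "g \<in> L2 M"
  shows "integrable M (\<lambda>x. f x * g x)"
proof (rule Bochner_Integration.integrable_bound)
  show "integrable M (\<lambda>x. (f x)\<^sup>2 + (g x)\<^sup>2)"
    using assms by (intro Bochner_Integration.integrable_add L2_integrable_square)
  show "(\<lambda>x. f x * g x) \<in> borel_measurable M"
    using assms[THEN L2_measurable] by simp
  have "\<bar>a * b\<bar> \<le> a\<^sup>2 + b\<^sup>2" for a b :: real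
  proof -
    have "2 * \<bar>a * b\<bar> \<le> a\<^sup>2 + b\<^sup>2"
      using sum_squares_bound[of "\<bar>a\<bar>" "\<bar>b\<bar>"] by (simp add: abs_mult mult.assoc)
    then show ?thesis
      by linarith
  qed
  then show "AE x in M. norm (f x * g x) \<le> norm ((f x)\<^sup>2 + (g x)\<^sup>2)"
    by (intro AE_I2) simp
qed

lemma L2_lincomb:
  assumes "f \<in> L2 M" "g \<in> L2 M"
  shows "(\<lambda>x. a * f x + b * g x) \<in> L2 M"
proof -
  have "integrable M (\<lambda>x. a\<^sup>2 * (f x)\<^sup>2 + (2 * a * b) * (f x * g x) + b\<^sup>2 * (g x)\<^sup>2)"
    using assms by (intro Bochner_Integration.integrable_add integrable_mult_right
        L2_integrable_mult L2_integrable_square)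
  also have "(\<lambda>x. a\<^sup>2 * (f x)\<^sup>2 + (2 * a * b) * (f x * g x) + b\<^sup>2 * (g x)\<^sup>2)
      = (\<lambda>x. (a * f x + b * g x)\<^sup>2)"
    by (simp add: power2_eq_square algebra_simps)
  finally show ?thesis
    using assms[THEN L2_measurable] by (simp add: L2_def)
qed

lemma L2_diff: "f \<in> L2 M \<Longrightarrow> g \<in> L2 M \<Longrightarrow> (\<lambda>x. f x - g x) \<in> L2 M"
  using L2_lincomb[of f M g 1 "- 1"] by simp

lemma L2_uminus: "f \<in> L2 M \<Longrightarrow> (\<lambda>x. - f x) \<in> L2 M"
  using L2_lincomb[of f M f "- 1" 0] by simp

lemma l2_inner_lincomb:
  assumes "h \<in> L2 M" "f \<in> L2 M" "g \<in> L2 M"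
  shows "l2_inner M h (\<lambda>x. a * f x + b * g x) = a * l2_inner M h f + b * l2_inner M h g"
proof -
  have "l2_inner M h (\<lambda>x. a * f x + b * g x) = (\<integral>x. a * (h x * f x) + b * (h x * g x) \<partial>M)"
    unfolding l2_inner_def by (simp add: algebra_simps)
  also have "\<dots> = a * l2_inner M h f + b * l2_inner M h g"
    unfolding l2_inner_def using assms
    by (subst Bochner_Integration.integral_add) (auto intro!: integrable_mult_right L2_integrable_mult)
  finally show ?thesis .
qed

lemma l2_inner_diff:
  assumes "h \<in> L2 M" "f \<in> L2 M" "g \<in> L2 M"
  shows "l2_inner M h (\<lambda>x. f x - g x) = l2_inner M h f - l2_inner M h g"
  using l2_inner_lincomb[OF assms, of 1 "- 1"] by simp

lemma l2_inner_uminus: "l2_inner M h (\<lambda>x. - f x) = - l2_inner M h f"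
  by (simp add: l2_inner_def)

lemma l2_inner_commute: "l2_inner M f g = l2_inner M g f"
  by (simp add: l2_inner_def mult.commute)

lemma l2_inner_diff_left:
  assumes "h \<in> L2 M" "f \<in> L2 M" "g \<in> L2 M"
  shows "l2_inner M (\<lambda>x. f x - g x) h = l2_inner M f h - l2_inner M g h"
  using l2_inner_diff[OF assms] by (simp add: l2_inner_commute)

lemma l2_inner_cong_AE:
  assumes "f \<in> L2 M" "g \<in> L2 M" "g' \<in> L2 M" "AE x in M. g x = g' x"
  shows "l2_inner M f g = l2_inner M f g'"
  unfolding l2_inner_def using assms by (intro integral_cong_AE) auto

lemma l2_norm_nonneg: "0 \<le> l2_norm M f"
  by (simp add: l2_norm_def l2_inner_def)

lemma l2_norm_square: "(l2_norm M f)\<^sup>2 = l2_inner M f f"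
  by (simp add: l2_norm_def l2_inner_def)

lemma l2_Cauchy_Schwarz:
  assumes f: "f \<in> L2 M" and g: "g \<in> L2 M"
  shows "\<bar>l2_inner M f g\<bar> \<le> l2_norm M f * l2_norm M g"
proof -
  define a b c where "a = l2_inner M f f" and "b = l2_inner M g g" and "c = l2_inner M f g"
  have "a \<ge> 0" "b \<ge> 0"
    by (simp_all add: a_def b_def l2_inner_def)
  have "c\<^sup>2 \<le> a * b"
  \<comment> \<open>If \<open>b = 0\<close>, then \<open>g\<close> vanishes almost everywhere and
    \<open>c\<close> is the integral of a null function; the quadratic expansion below cancels a
    factor \<open>b\<close>, so it needs \<open>b\<close> nonzero.\<close>
  proof (cases "b = 0")
    case True
    then have "AE x in M. g x * g x = 0"
      using integral_nonneg_eq_0_iff_AE[OF L2_integrable_mult[OF g g]]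
      by (simp add: b_def l2_inner_def)
    then have "AE x in M. f x * g x = 0"
      by auto
    then have "c = 0"
      unfolding c_def l2_inner_def by (rule integral_eq_zero_AE)
    with \<open>a \<ge> 0\<close> \<open>b \<ge> 0\<close> show ?thesis
      by simp
  next
    case False
    \<comment> \<open>\<open>?h\<close> is \<open>b\<close> times the component of \<open>f\<close>
      orthogonal to \<open>g\<close>.\<close>
    let ?h = "\<lambda>x. b * f x + (- c) * g x"
    have h: "?h \<in> L2 M"
      using f g by (rule L2_lincomb)
    have "0 \<le> l2_inner M ?h ?h"
      by (simp add: l2_inner_def)
    also have "\<dots> = b * (a * b - c\<^sup>2)"
      unfolding l2_inner_lincomb[OF h f g] l2_inner_commute[of M ?h f] l2_inner_commute[of M ?h g]
        l2_inner_lincomb[OF f f g] l2_inner_lincomb[OF g f g]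
      by (simp add: a_def b_def c_def l2_inner_commute[of M g f] power2_eq_square algebra_simps)
    finally show ?thesis
      using False \<open>b \<ge> 0\<close> by (simp add: zero_le_mult_iff)
  qed
  then have "\<bar>c\<bar> \<le> sqrt (a * b)"
    using real_sqrt_le_mono[of "c\<^sup>2" "a * b"] by simp
  then show ?thesis
    by (simp add: l2_norm_def a_def b_def c_def real_sqrt_mult)
qed

section \<open>Invariant Markov semigroups\<close>

text \<open>Tonelli for kernels is applied to the positive part, the negative part and the absolute
  value of \<open>f\<close>. Integrability under \<open>M \<bind> N\<close> makes the three outer
  integrals finite, so the inner ones are finite almost everywhere and may be subtracted.\<close>

lemma
  fixes f :: "'b \<Rightarrow> real"
  assumes N [measurable]: "N \<in> M \<rightarrow>\<^sub>M subprob_algebra B" and ne: "space M \<noteq> {}"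
    and f: "integrable (M \<bind> N) f"
  shows AE_integrable_kernel: "AE x in M. integrable (N x) f"
    and integrable_integral_kernel: "integrable M (\<lambda>x. \<integral>y. f y \<partial>N x)"
    and integral_bind_integrable: "integral\<^sup>L (M \<bind> N) f = (\<integral>x. \<integral>y. f y \<partial>N x \<partial>M)"
proof -
  have sets_N: "sets (N x) = sets B" if "x \<in> space M" for x
    using subprob_measurableD(2)[OF N that] .
  have "sets (M \<bind> N) = sets B"
    by (rule sets_bind[OF sets_N ne])
  then have f_meas [measurable]: "f \<in> borel_measurable B"
    using borel_measurable_integrable[OF f] by (simp cong: measurable_cong_sets)
  have f_N [measurable]: "f \<in> borel_measurable (N x)" if "x \<in> space M" for x
    using f_meas sets_N[OF that] by (simp cong: measurable_cong_sets)
  \<comment> \<open>\<open>ennreal\<close> sends negative reals to 0, so \<open>p\<close>,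
    \<open>m\<close> and \<open>q\<close> integrate the positive part, the negative part and the
    absolute value of \<open>f\<close>.\<close>
  define p m q where "p = (\<lambda>x. \<integral>\<^sup>+y. ennreal (f y) \<partial>N x)" and "m = (\<lambda>x. \<integral>\<^sup>+y. ennreal (- f y) \<partial>N x)"
    and "q = (\<lambda>x. \<integral>\<^sup>+y. ennreal (norm (f y)) \<partial>N x)"
  have [measurable]: "p \<in> borel_measurable M" "m \<in> borel_measurable M" "q \<in> borel_measurable M"
    unfolding p_def m_def q_def by measurable
  have [measurable]: "(\<lambda>x. \<integral>y. f y \<partial>N x) \<in> borel_measurable M"
    by measurable
  have bind_p: "(\<integral>\<^sup>+y. ennreal (f y) \<partial>(M \<bind> N)) = (\<integral>\<^sup>+x. p x \<partial>M)"
    and bind_m: "(\<integral>\<^sup>+y. ennreal (- f y) \<partial>(M \<bind> N)) = (\<integral>\<^sup>+x. m x \<partial>M)"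
    and bind_q: "(\<integral>\<^sup>+y. ennreal (norm (f y)) \<partial>(M \<bind> N)) = (\<integral>\<^sup>+x. q x \<partial>M)"
    unfolding p_def m_def q_def by (subst nn_integral_bind[OF _ N]; simp)+
  have q_fin: "(\<integral>\<^sup>+x. q x \<partial>M) < \<infinity>"
    using f bind_q by (simp add: integrable_iff_bounded)
  have p_le: "p x \<le> q x" and m_le: "m x \<le> q x" for x
    unfolding p_def m_def q_def by (intro nn_integral_mono ennreal_leI; simp)+
  have AE_q: "AE x in M. q x \<noteq> \<infinity>"
    using q_fin by (intro nn_integral_PInf_AE) auto
  then show int_N: "AE x in M. integrable (N x) f"
    using AE_space
  proof eventually_elim
    case (elim x)
    then show ?case
      using f_N[of x] by (auto simp: integrable_iff_bounded q_def less_top)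
  qed
  \<comment> \<open>Where \<open>f\<close> is not integrable the inner integral is 0 by convention,
    so the bound holds at every \<open>x\<close>, without an exceptional set.\<close>
  have norm_le: "ennreal (norm (\<integral>y. f y \<partial>N x)) \<le> q x" for x
    unfolding q_def
    by (cases "integrable (N x) f") (use integral_norm_bound_ennreal[of "N x" f] in \<open>simp_all add: not_integrable_integral_eq\<close>)
  have "(\<integral>\<^sup>+x. ennreal (norm (\<integral>y. f y \<partial>N x)) \<partial>M) \<le> (\<integral>\<^sup>+x. q x \<partial>M)"
    by (intro nn_integral_mono norm_le)
  then show "integrable M (\<lambda>x. \<integral>y. f y \<partial>N x)"
    using q_fin by (auto simp: integrable_iff_bounded)
  have fin: "(\<integral>\<^sup>+x. p x \<partial>M) < \<infinity>" "(\<integral>\<^sup>+x. m x \<partial>M) < \<infinity>"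
    using q_fin nn_integral_mono[of M p q] nn_integral_mono[of M m q] p_le m_le
    by (auto intro: le_less_trans)
  \<comment> \<open>\<open>enn2real\<close> maps \<open>\<infinity>\<close> to 0; the finite
    integral of \<open>g\<close> confines this to a null set.\<close>
  have enn2real_integral: "integrable M (\<lambda>x. enn2real (g x)) \<and>
      (\<integral>x. enn2real (g x) \<partial>M) = enn2real (\<integral>\<^sup>+x. g x \<partial>M)"
    if [measurable]: "g \<in> borel_measurable M" and g: "(\<integral>\<^sup>+x. g x \<partial>M) < \<infinity>" for g
  proof -
    have "AE x in M. g x \<noteq> \<infinity>"
      using g by (intro nn_integral_PInf_AE) auto
    then have "AE x in M. ennreal (enn2real (g x)) = g x"
      by eventually_elim (simp add: less_top)
    then have eq: "(\<integral>\<^sup>+x. ennreal (enn2real (g x)) \<partial>M) = (\<integral>\<^sup>+x. g x \<partial>M)"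
      by (rule nn_integral_cong_AE)
    then show ?thesis
      using g by (simp add: integral_eq_nn_integral integrable_iff_bounded)
  qed
  have "integral\<^sup>L (M \<bind> N) f = enn2real (\<integral>\<^sup>+x. p x \<partial>M) - enn2real (\<integral>\<^sup>+x. m x \<partial>M)"
    using f by (simp add: real_lebesgue_integral_def bind_p bind_m)
  also have "\<dots> = (\<integral>x. enn2real (p x) - enn2real (m x) \<partial>M)"
    using fin by (simp add: enn2real_integral)
  also have "\<dots> = (\<integral>x. \<integral>y. f y \<partial>N x \<partial>M)"
  proof (rule integral_cong_AE)
    show "AE x in M. enn2real (p x) - enn2real (m x) = (\<integral>y. f y \<partial>N x)"
      using int_N by eventually_elim (simp add: real_lebesgue_integral_def p_def m_def)
  qed simp_all
  finally show "integral\<^sup>L (M \<bind> N) f = (\<integral>x. \<integral>y. f y \<partial>N x \<partial>M)" .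
qed

section \<open>Contraction and semigroup law on square-integrable functions\<close>

locale invariant_markov_semigroup = prob_space M
  for M :: "'e measure" +
  fixes P :: "real \<Rightarrow> 'e \<Rightarrow> 'e measure"
  assumes transition: "transition_semigroup M P" and invar: "invariant M P"
begin

lemma kernel_prob: "0 \<le> t \<Longrightarrow> P t \<in> M \<rightarrow>\<^sub>M prob_algebra M"
  using transition by (simp add: transition_semigroup_def)

lemma kernel [measurable]: "0 \<le> t \<Longrightarrow> P t \<in> M \<rightarrow>\<^sub>M subprob_algebra M"
  by (intro measurable_prob_algebraD kernel_prob)

lemma prob_space_kernel: "0 \<le> t \<Longrightarrow> x \<in> space M \<Longrightarrow> prob_space (P t x)"
  using measurable_space[OF kernel_prob, of t x] by (simp add: space_prob_algebra)

lemma sets_kernel: "0 \<le> t \<Longrightarrow> x \<in> space M \<Longrightarrow> sets (P t x) = sets M"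
  using measurable_space[OF kernel_prob, of t x] by (simp add: space_prob_algebra)

lemma bind_kernel: "0 \<le> t \<Longrightarrow> M \<bind> P t = M"
  using invar by (simp add: invariant_def)

lemma measurable_semigroup_op [measurable]:
  assumes t: "0 \<le> t" and f: "f \<in> borel_measurable M"
  shows "semigroup_op P t f \<in> borel_measurable M"
  unfolding semigroup_op_def
  using measurable_compose[OF kernel[OF t] integral_measurable_subprob_algebra[OF f]] .

lemma AE_integrable_semigroup:
  fixes f :: "'e \<Rightarrow> real"
  assumes "0 \<le> t" "integrable M f"
  shows "AE x in M. integrable (P t x) f"
  using AE_integrable_kernel[OF kernel not_empty, of t f] assms by (simp add: bind_kernel)

lemma integrable_semigroup_op: "0 \<le> t \<Longrightarrow> integrable M f \<Longrightarrow> integrable M (semigroup_op P t f)"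
  unfolding semigroup_op_def using integrable_integral_kernel[OF kernel not_empty, of t f]
  by (simp add: bind_kernel)

lemma integral_semigroup_op:
  "0 \<le> t \<Longrightarrow> integrable M f \<Longrightarrow> (\<integral>x. semigroup_op P t f x \<partial>M) = (\<integral>x. f x \<partial>M)"
  unfolding semigroup_op_def using integral_bind_integrable[OF kernel not_empty, of t f]
  by (simp add: bind_kernel)

lemma L2_integrable: "f \<in> L2 M \<Longrightarrow> integrable M f"
  using square_integrable_imp_integrable[OF L2_measurable L2_integrable_square] .

lemma L2_const: "(\<lambda>x. c) \<in> L2 M"
  by (simp add: L2_def)

text \<open>Jensen's inequality for the square: the variance of \<open>f\<close> under the
  probability measure \<open>P t x\<close> is nonnegative.\<close>

lemma AE_semigroup_op_square_le:
  assumes t: "0 \<le> t" and f: "f \<in> L2 M"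
  shows "AE x in M. (semigroup_op P t f x)\<^sup>2 \<le> semigroup_op P t (\<lambda>x. (f x)\<^sup>2) x"
  using AE_integrable_semigroup[OF t L2_integrable[OF f]]
    AE_integrable_semigroup[OF t L2_integrable_square[OF f]] AE_space
proof eventually_elim
  case (elim x)
  interpret K: prob_space "P t x"
    using t elim by (intro prob_space_kernel)
  show ?case
    using K.variance_positive[of f] elim by (simp add: K.variance_eq semigroup_op_def)
qed

text \<open>Integrating the pointwise Jensen inequality gives both claims, since invariance turns
  the mean of \<open>semigroup_op P t\<close> of the square back into the mean of the
  square.\<close>

lemma
  assumes t: "0 \<le> t" and f: "f \<in> L2 M"
  shows semigroup_op_L2: "semigroup_op P t f \<in> L2 M"
    and l2_norm_semigroup_op_le: "l2_norm M (semigroup_op P t f) \<le> l2_norm M f"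
proof -
  have [measurable]: "semigroup_op P t f \<in> borel_measurable M"
    by (rule measurable_semigroup_op[OF t L2_measurable[OF f]])
  note sq = integrable_semigroup_op[OF t L2_integrable_square[OF f]]
  have int: "integrable M (\<lambda>x. (semigroup_op P t f x)\<^sup>2)"
    by (rule Bochner_Integration.integrable_bound[OF sq])
       (use AE_semigroup_op_square_le[OF t f] in auto)
  then show "semigroup_op P t f \<in> L2 M"
    by (simp add: L2_def)
  have "(\<integral>x. (semigroup_op P t f x)\<^sup>2 \<partial>M) \<le> (\<integral>x. (f x)\<^sup>2 \<partial>M)"
    using integral_mono_AE[OF int sq AE_semigroup_op_square_le[OF t f]]
    by (simp add: integral_semigroup_op[OF t L2_integrable_square[OF f]])
  then show "l2_norm M (semigroup_op P t f) \<le> l2_norm M f"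
    by (simp add: l2_norm_def l2_inner_def power2_eq_square)
qed

text \<open>Linearity is claimed only almost everywhere: at points where \<open>f\<close> or
  \<open>g\<close> is not integrable under \<open>P t x\<close>, the integrals take the default
  value 0.\<close>

lemma semigroup_op_lincomb:
  assumes t: "0 \<le> t" and f: "integrable M f" and g: "integrable M g"
  shows "AE x in M. semigroup_op P t (\<lambda>x. a * f x + b * g x) x
           = a * semigroup_op P t f x + b * semigroup_op P t g x"
  using AE_integrable_semigroup[OF t f] AE_integrable_semigroup[OF t g]
  by eventually_elim (simp add: semigroup_op_def)

text \<open>Chapman-Kolmogorov, read as an iterated integral at every \<open>x\<close> for which
  \<open>f\<close> is integrable under \<open>P (s + t) x\<close>.\<close>

lemma semigroup_op_add_time:
  assumes s: "0 \<le> s" and t: "0 \<le> t" and f: "integrable M f"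
  shows "AE x in M. semigroup_op P (s + t) f x = semigroup_op P s (semigroup_op P t f) x"
  using AE_integrable_semigroup[OF add_nonneg_nonneg[OF s t] f] AE_space
proof eventually_elim
  case (elim x)
  then have eq: "P (s + t) x = P s x \<bind> P t"
    using transition s t unfolding transition_semigroup_def by blast
  have meas: "P t \<in> P s x \<rightarrow>\<^sub>M subprob_algebra M"
    using kernel[OF t] sets_kernel[OF s elim(2)] by (simp cong: measurable_cong_sets)
  have ne: "space (P s x) \<noteq> {}"
    using prob_space.not_empty[OF prob_space_kernel[OF s elim(2)]] .
  show ?case
    using integral_bind_integrable[OF meas ne] elim(1) by (simp add: semigroup_op_def eq)
qed

lemma semigroup_op_0:
  assumes "x \<in> space M" "f \<in> borel_measurable M"
  shows "semigroup_op P 0 f x = f x"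
  using transition assms unfolding transition_semigroup_def semigroup_op_def
  by (simp add: integral_return)

section \<open>Correlations as real functions of time\<close>

text \<open>Pairing with a fixed \<open>f\<close> turns almost-everywhere identities into equalities
  of numbers and reduces calculus along the semigroup to calculus of real functions. For the
  stationary process this is the expectation of \<open>f\<close> at one time times \<open>g\<close>
  at a time \<open>t\<close> later.\<close>

definition correlation :: "('e \<Rightarrow> real) \<Rightarrow> ('e \<Rightarrow> real) \<Rightarrow> real \<Rightarrow> real" where
  "correlation f g t = l2_inner M f (semigroup_op P t g)"

lemma correlation_0: "f \<in> L2 M \<Longrightarrow> g \<in> L2 M \<Longrightarrow> correlation f g 0 = l2_inner M f g"
  unfolding correlation_def l2_inner_def
  by (intro Bochner_Integration.integral_cong) (auto simp: semigroup_op_0)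

lemma correlation_le:
  assumes "0 \<le> t" "f \<in> L2 M" "g \<in> L2 M"
  shows "\<bar>correlation f g t\<bar> \<le> l2_norm M f * l2_norm M g"
  unfolding correlation_def
  using l2_Cauchy_Schwarz[OF assms(2) semigroup_op_L2[OF assms(1,3)]]
    mult_left_mono[OF l2_norm_semigroup_op_le[OF assms(1,3)] l2_norm_nonneg[of M f]]
  by simp

lemma correlation_lincomb:
  assumes t: "0 \<le> t" and f: "f \<in> L2 M" and g: "g \<in> L2 M" and h: "h \<in> L2 M"
  shows "correlation f (\<lambda>x. a * g x + b * h x) t = a * correlation f g t + b * correlation f h t"
  unfolding correlation_def l2_inner_lincomb[OF f semigroup_op_L2[OF t g] semigroup_op_L2[OF t h], symmetric]
  using assms by (intro l2_inner_cong_AE semigroup_op_lincomb L2_lincomb semigroup_op_L2 L2_integrable)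

lemma correlation_diff:
  assumes t: "0 \<le> t" and f: "f \<in> L2 M" and g: "g \<in> L2 M" and h: "h \<in> L2 M"
  shows "correlation f (\<lambda>x. g x - h x) t = correlation f g t - correlation f h t"
  using correlation_lincomb[OF assms, of 1 "- 1"] by simp

lemma correlation_uminus: "correlation f (\<lambda>x. - g x) t = - correlation f g t"
  by (simp add: correlation_def semigroup_op_def l2_inner_def)

lemma correlation_semigroup_op:
  assumes s: "0 \<le> s" and t: "0 \<le> t" and f: "f \<in> L2 M" and g: "g \<in> L2 M"
  shows "correlation f (semigroup_op P t g) s = correlation f g (s + t)"
  unfolding correlation_def
proof (rule l2_inner_cong_AE[OF f])
  show "AE x in M. semigroup_op P s (semigroup_op P t g) x = semigroup_op P (s + t) g x"
    using semigroup_op_add_time[OF s t L2_integrable[OF g]] by eventually_elim simp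
qed (use assms in \<open>auto intro!: semigroup_op_L2\<close>)

text \<open>The increment is the semigroup at time \<open>a\<close> applied to
  \<open>semigroup_op P (b - a) g - g\<close>. Contraction leaves a bound depending on
  \<open>a\<close> and \<open>b\<close> only through \<open>b - a\<close>.\<close>

lemma correlation_increment_le:
  assumes a: "0 \<le> a" "a \<le> b" and f: "f \<in> L2 M" and g: "g \<in> L2 M"
  shows "\<bar>correlation f g b - correlation f g a\<bar>
           \<le> l2_norm M f * l2_norm M (\<lambda>x. semigroup_op P (b - a) g x - g x)"
proof -
  have d: "0 \<le> b - a"
    using a by simp
  note Pg = semigroup_op_L2[OF d g]
  have "correlation f g b - correlation f g a
      = correlation f (\<lambda>x. semigroup_op P (b - a) g x - g x) a"
    using correlation_diff[OF a(1) f Pg g] correlation_semigroup_op[OF a(1) d f g] by simp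
  then show ?thesis
    using correlation_le[OF a(1) f L2_diff[OF Pg g]] by simp
qed

text \<open>The semigroup at time \<open>a\<close> is factored out of the difference quotient, so
  the error is controlled by the error at time 0, uniformly in the left endpoint
  \<open>a\<close>.\<close>

lemma correlation_generator_le:
  assumes a: "0 \<le> a" "a < b" and f: "f \<in> L2 M" and uv: "(u, v) \<in> generator M P"
  shows "\<bar>correlation f u b - correlation f u a - (b - a) * correlation f v a\<bar>
           \<le> (b - a) * (l2_norm M f * l2_norm M (\<lambda>x. (semigroup_op P (b - a) u x - u x) / (b - a) - v x))"
proof -
  have u: "u \<in> L2 M" and v: "v \<in> L2 M"
    using uv unfolding generator_def by blast+
  have d: "0 \<le> b - a"
    using a by simp
  note Pu = semigroup_op_L2[OF d u]
  let ?w = "\<lambda>x. (semigroup_op P (b - a) u x - u x) / (b - a) - v x"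
  have w_eq: "?w = (\<lambda>x. (1 / (b - a)) * (semigroup_op P (b - a) u x - u x) + (- 1) * v x)"
    by simp
  have w: "?w \<in> L2 M"
    unfolding w_eq using L2_diff[OF Pu u] v by (rule L2_lincomb)
  have "correlation f ?w a = (correlation f u b - correlation f u a) / (b - a) - correlation f v a"
    unfolding w_eq correlation_lincomb[OF a(1) f L2_diff[OF Pu u] v]
    using correlation_diff[OF a(1) f Pu u] correlation_semigroup_op[OF a(1) d f u] by simp
  moreover have "(b - a) * ((correlation f u b - correlation f u a) / (b - a))
      = correlation f u b - correlation f u a"
    using a by simp
  ultimately have "correlation f u b - correlation f u a - (b - a) * correlation f v a
      = (b - a) * correlation f ?w a"
    by (simp only: right_diff_distrib)
  then have "\<bar>correlation f u b - correlation f u a - (b - a) * correlation f v a\<bar>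
      = (b - a) * \<bar>correlation f ?w a\<bar>"
    using d by (simp only: abs_mult abs_of_nonneg)
  then show ?thesis
    using mult_left_mono[OF correlation_le[OF a(1) f w] d] by simp
qed

text \<open>Because the semigroup contracts, the difference quotients of \<open>t \<mapsto> \<langle>u, P t u\<rangle>\<close> at 0 are nonpositive.\<close>

lemma generator_nonpos:
  assumes uv: "(u, v) \<in> generator M P"
  shows "l2_inner M u v \<le> 0"
proof -
  have u: "u \<in> L2 M" and v: "v \<in> L2 M"
    and lim: "((\<lambda>t. l2_norm M (\<lambda>x. (semigroup_op P t u x - u x) / t - v x)) \<longlongrightarrow> 0) (at_right 0)"
    using uv unfolding generator_def by blast+
  let ?e = "\<lambda>t. l2_norm M (\<lambda>x. (semigroup_op P t u x - u x) / t - v x)"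
  have "((\<lambda>t. l2_norm M u * ?e t) \<longlongrightarrow> l2_norm M u * 0) (at_right 0)"
    by (intro tendsto_intros lim)
  moreover have "\<forall>\<^sub>F t in at_right 0. l2_inner M u v \<le> l2_norm M u * ?e t"
    using eventually_at_right_less[of 0]
  proof eventually_elim
    case (elim t)
    have "t * correlation u v 0 - (correlation u u t - correlation u u 0) \<le> t * (l2_norm M u * ?e t)"
      using correlation_generator_le[OF order_refl elim u uv] by simp
    \<comment> \<open>Cauchy-Schwarz and contraction bound the left side by the squared norm of
      \<open>u\<close>, which is the value at time 0.\<close>
    moreover have "correlation u u t \<le> correlation u u 0"
      using correlation_le[of t u u] elim u
      by (simp add: correlation_0 l2_norm_square[symmetric] power2_eq_square)
    ultimately have "t * l2_inner M u v \<le> t * (l2_norm M u * ?e t)"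
      using u v by (simp add: correlation_0)
    then show ?case
      using elim by simp
  qed
  ultimately have "l2_inner M u v \<le> l2_norm M u * 0"
    by (rule tendsto_lowerbound) simp
  then show ?thesis
    by simp
qed

end

section \<open>Continuity and differentiability of correlations\<close>

locale continuous_markov_semigroup = invariant_markov_semigroup +
  assumes strong_cont: "strongly_continuous M P"
begin

text \<open>Strong continuity speaks only about time 0; \<open>correlation_increment_le\<close>
  carries it to every time with the common modulus \<open>e\<close>, from either side.\<close>

lemma continuous_on_correlation:
  assumes f: "f \<in> L2 M" and g: "g \<in> L2 M"
  shows "continuous_on {0..} (correlation f g)"
proof -
  define e where "e = (\<lambda>d. l2_norm M f * l2_norm M (\<lambda>x. semigroup_op P d g x - g x))"
  have "((\<lambda>t. l2_norm M (\<lambda>x. semigroup_op P t g x - g x)) \<longlongrightarrow> 0) (at_right 0)"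
    using strong_cont g unfolding strongly_continuous_def by blast
  then have "(e \<longlongrightarrow> l2_norm M f * 0) (at_right 0)"
    unfolding e_def by (intro tendsto_intros)
  then have e: "(e \<longlongrightarrow> 0) (at_right 0)"
    by simp
  show ?thesis
    unfolding continuous_on_iff
  proof (intro ballI allI impI)
    fix x :: real and r :: real
    assume "x \<in> {0..}" "0 < r"
    then obtain d where d: "0 < d" "\<And>y. 0 < y \<Longrightarrow> y < d \<Longrightarrow> \<bar>e y\<bar> < r"
      using tendstoD[OF e, of r] by (auto simp: eventually_at_right_field)
    have "\<bar>correlation f g y - correlation f g x\<bar> < r" if "0 \<le> y" "\<bar>y - x\<bar> < d" for y
    proof (cases x y rule: linorder_cases)
      case less
      then show ?thesis
        using correlation_increment_le[of x y f g] d(2)[of "y - x"] that f g \<open>x \<in> {0..}\<close>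
        by (simp add: e_def)
    next
      case equal
      then show ?thesis using \<open>0 < r\<close> by simp
    next
      case greater
      then show ?thesis
        using correlation_increment_le[of y x f g] d(2)[of "x - y"] that f g
        by (simp add: e_def abs_minus_commute)
    qed
    then show "\<exists>d>0. \<forall>x'\<in>{0..}. dist x' x < d \<longrightarrow> dist (correlation f g x') (correlation f g x) < r"
      using d(1) by (auto simp: dist_real_def)
  qed
qed

text \<open>Right difference quotients are covered directly by
  \<open>correlation_generator_le\<close>. Left ones are estimated from the moving left endpoint,
  and continuity of \<open>correlation f v\<close> brings that endpoint back to
  \<open>t\<close>.\<close>

lemma correlation_has_derivative:
  assumes f: "f \<in> L2 M" and uv: "(u, v) \<in> generator M P" and t: "0 \<le> t"
  shows "(correlation f u has_real_derivative correlation f v t) (at t within {0..})"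
proof -
  have u: "u \<in> L2 M" and v: "v \<in> L2 M"
    and lim: "((\<lambda>t. l2_norm M (\<lambda>x. (semigroup_op P t u x - u x) / t - v x)) \<longlongrightarrow> 0) (at_right 0)"
    using uv unfolding generator_def by blast+
  define e where "e = (\<lambda>d. l2_norm M f * l2_norm M (\<lambda>x. (semigroup_op P d u x - u x) / d - v x))"
  have "(e \<longlongrightarrow> l2_norm M f * 0) (at_right 0)"
    unfolding e_def by (intro tendsto_intros lim)
  then have e: "(e \<longlongrightarrow> 0) (at_right 0)"
    by simp
  show ?thesis
    unfolding has_field_derivative_iff tendsto_iff
  proof (intro allI impI)
    fix r :: real assume "0 < r"
    then obtain d where d: "0 < d" "\<And>y. 0 < y \<Longrightarrow> y < d \<Longrightarrow> \<bar>e y\<bar> < r / 2"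
      using tendstoD[OF e, of "r / 2"] by (auto simp: eventually_at_right_field)
    obtain d' where d': "0 < d'"
      "\<And>y. 0 \<le> y \<Longrightarrow> \<bar>y - t\<bar> < d' \<Longrightarrow> \<bar>correlation f v y - correlation f v t\<bar> < r / 2"
      using continuous_on_correlation[OF f v] t \<open>0 < r\<close>
      unfolding continuous_on_iff dist_real_def by (metis atLeast_iff half_gt_zero)
    have est: "\<bar>(correlation f u b - correlation f u a) / (b - a) - correlation f v a\<bar> < r / 2"
      if "0 \<le> a" "a < b" "b - a < d" for a b
    proof -
      have "\<bar>correlation f u b - correlation f u a - (b - a) * correlation f v a\<bar> \<le> (b - a) * e (b - a)"
        unfolding e_def using correlation_generator_le[OF that(1,2) f uv] .
      also have "\<dots> < (b - a) * (r / 2)"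
        using d(2)[of "b - a"] that by (intro mult_strict_left_mono) auto
      finally have "\<bar>correlation f u b - correlation f u a - (b - a) * correlation f v a\<bar> / (b - a) < r / 2"
        using that by (simp add: pos_divide_less_eq mult.commute)
      moreover have "(correlation f u b - correlation f u a) / (b - a) - correlation f v a
          = (correlation f u b - correlation f u a - (b - a) * correlation f v a) / (b - a)"
        using that by (simp add: diff_divide_distrib)
      ultimately show ?thesis
        using that by (simp add: abs_divide)
    qed
    have "dist ((correlation f u y - correlation f u t) / (y - t)) (correlation f v t) < r"
      if "0 \<le> y" "y \<noteq> t" "\<bar>y - t\<bar> < min d d'" for y
    proof (cases "t < y")
      case True
      then show ?thesis
        using est[of t y] that t \<open>0 < r\<close> by (simp add: dist_real_def)
    next
      \<comment> \<open>Now \<open>y < t\<close>, so \<open>est\<close> compares with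
        \<open>correlation f v y\<close>; replacing it by \<open>correlation f v t\<close> costs the
        other \<open>r / 2\<close>, by the choice of \<open>d'\<close>.\<close>
      case False
      then have "(correlation f u y - correlation f u t) / (y - t)
          = (correlation f u t - correlation f u y) / (t - y)"
        by (metis minus_diff_eq minus_divide_divide)
      then show ?thesis
        using est[of y t] d'(2)[of y] that False unfolding dist_real_def by linarith
    qed
    then show "\<forall>\<^sub>F y in at t within {0..}.
        dist ((correlation f u y - correlation f u t) / (y - t)) (correlation f v t) < r"
      unfolding eventually_at using d(1) d'(1)
      by (intro exI[of _ "min d d'"]) (auto simp: dist_real_def)
  qed
qed

end

section \<open>Stationary Markov processes\<close>

text \<open>\<open>C\<close> and \<open>D\<close> are successive antiderivatives of \<open>c\<close>
  vanishing at 0. Splitting the inner integral at \<open>r = s\<close> gives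
  \<open>C s + C (t - s)\<close>, and both summands have integral \<open>D t\<close>.\<close>

lemma double_integral_abs_diff:
  fixes c C D :: "real \<Rightarrow> real"
  assumes c: "continuous_on {0..} c"
    and C: "\<And>x. 0 \<le> x \<Longrightarrow> (C has_real_derivative c x) (at x within {0..})" and C0: "C 0 = 0"
    and D: "\<And>x. 0 \<le> x \<Longrightarrow> (D has_real_derivative C x) (at x within {0..})" and D0: "D 0 = 0"
    and t: "0 \<le> t"
  shows "(LINT s:{0..t}|lborel. LINT r:{0..t}|lborel. c \<bar>s - r\<bar>) = 2 * D t"
proof -
  \<comment> \<open>\<open>shift\<close> serves the range above \<open>s\<close>, where the argument
    is \<open>r - s\<close>; \<open>reflect\<close> serves the range below, where it is
    \<open>s - r\<close> and the antiderivative changes sign.\<close>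
  have shift: "((\<lambda>r. F (r - a)) has_vector_derivative F' (r - a)) (at r within {a..b})"
    if "\<And>x. 0 \<le> x \<Longrightarrow> (F has_real_derivative F' x) (at x within {0..})" "a \<le> r"
    for F F' :: "real \<Rightarrow> real" and a b r
  proof -
    have "(F has_real_derivative F' (r - a)) (at (r - a) within (\<lambda>r. r - a) ` {a..b})"
      using that by (intro has_field_derivative_subset[OF that(1)]) auto
    moreover have "((\<lambda>r. r - a) has_real_derivative 1) (at r within {a..b})"
      by (auto intro!: derivative_eq_intros)
    ultimately have "(F \<circ> (\<lambda>r. r - a) has_real_derivative F' (r - a) * 1) (at r within {a..b})"
      by (rule DERIV_image_chain)
    then show ?thesis
      by (simp add: has_real_derivative_iff_has_vector_derivative o_def)
  qed
  have reflect: "((\<lambda>r. - F (b - r)) has_vector_derivative F' (b - r)) (at r within {a..b})"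
    if "\<And>x. 0 \<le> x \<Longrightarrow> (F has_real_derivative F' x) (at x within {0..})" "r \<le> b"
    for F F' :: "real \<Rightarrow> real" and a b r
  proof -
    have "(F has_real_derivative F' (b - r)) (at (b - r) within (\<lambda>r. b - r) ` {a..b})"
      using that by (intro has_field_derivative_subset[OF that(1)]) auto
    moreover have "((\<lambda>r. b - r) has_real_derivative - 1) (at r within {a..b})"
      by (auto intro!: derivative_eq_intros)
    ultimately have "(F \<circ> (\<lambda>r. b - r) has_real_derivative F' (b - r) * - 1) (at r within {a..b})"
      by (rule DERIV_image_chain)
    then have "((\<lambda>r. - (F \<circ> (\<lambda>r. b - r)) r) has_real_derivative - (F' (b - r) * - 1)) (at r within {a..b})"
      by (rule DERIV_minus)
    then show ?thesis
      by (simp add: has_real_derivative_iff_has_vector_derivative o_def)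
  qed
  \<comment> \<open>The fundamental theorem of calculus yields gauge integrals; continuity on the
    compact interval identifies them with Lebesgue integrals.\<close>
  have to_integral: "(LINT r:{0..t}|lborel. q r) = I"
    if "continuous_on {0..t} q" "(q has_integral I) {0..t}" for q :: "real \<Rightarrow> real" and I
    using set_borel_integral_eq_integral(2)[OF borel_integrable_atLeastAtMost'[OF that(1)]]
      integral_unique[OF that(2)] by simp
  have contC: "continuous_on {0..} C"
    using C by (intro DERIV_continuous_on) auto
  have inner: "(LINT r:{0..t}|lborel. c \<bar>s - r\<bar>) = C s + C (t - s)" if s: "s \<in> {0..t}" for s
  proof (rule to_integral)
    show "continuous_on {0..t} (\<lambda>r. c \<bar>s - r\<bar>)"
      by (rule continuous_on_compose2[OF c]) (auto intro!: continuous_intros)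
    have "((\<lambda>r. c (s - r)) has_integral - C (s - s) - - C (s - 0)) {0..s}"
      using s by (intro fundamental_theorem_of_calculus reflect C) auto
    then have "((\<lambda>r. c \<bar>s - r\<bar>) has_integral C s) {0..s}"
      by (subst has_integral_cong[where g = "\<lambda>r. c (s - r)"]) (auto simp: C0)
    moreover have "((\<lambda>r. c (r - s)) has_integral C (t - s) - C (s - s)) {s..t}"
      using s by (intro fundamental_theorem_of_calculus shift C) auto
    then have "((\<lambda>r. c \<bar>s - r\<bar>) has_integral C (t - s)) {s..t}"
      by (subst has_integral_cong[where g = "\<lambda>r. c (r - s)"]) (auto simp: C0)
    ultimately show "((\<lambda>r. c \<bar>s - r\<bar>) has_integral C s + C (t - s)) {0..t}"
      using s by (intro has_integral_combine[where c = s]) auto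
  qed
  have "(LINT s:{0..t}|lborel. LINT r:{0..t}|lborel. c \<bar>s - r\<bar>) = (LINT s:{0..t}|lborel. C s + C (t - s))"
    by (intro set_lebesgue_integral_cong) (auto simp: inner)
  also have "\<dots> = 2 * D t"
  proof (rule to_integral)
    show "continuous_on {0..t} (\<lambda>s. C s + C (t - s))"
      by (intro continuous_on_add continuous_on_subset[OF contC] continuous_on_compose2[OF contC])
         (auto intro!: continuous_intros)
    have "((\<lambda>r. C (t - r)) has_integral - D (t - t) - - D (t - 0)) {0..t}"
      using t by (intro fundamental_theorem_of_calculus reflect D) auto
    moreover have "((\<lambda>r. C (r - 0)) has_integral D (t - 0) - D (0 - 0)) {0..t}"
      using t by (intro fundamental_theorem_of_calculus shift D) auto
    ultimately have "((\<lambda>s. C (t - s) + C (s - 0)) has_integral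
        (- D (t - t) - - D (t - 0)) + (D (t - 0) - D (0 - 0))) {0..t}"
      by (rule has_integral_add)
    then show "((\<lambda>s. C s + C (t - s)) has_integral 2 * D t) {0..t}"
      by (simp add: D0 add.commute)
  qed
  finally show ?thesis .
qed

section \<open>Laws of the process at one and at two times\<close>

locale stationary_process = prob_space M + W: prob_space W
  for M :: "'e measure" and W :: "'w measure" +
  fixes P :: "real \<Rightarrow> 'e \<Rightarrow> 'e measure" and X :: "real \<Rightarrow> 'w \<Rightarrow> 'e"
  assumes process: "stationary_markov_process M P W X"

sublocale stationary_process \<subseteq> continuous_markov_semigroup M P
  using process by unfold_locales (simp_all add: stationary_markov_process_def)

context stationary_process
begin

text \<open>Joint measurability is given for nonnegative times. Freezing the process at its initial
  value for negative times extends it to the whole line, where Borel product measurability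
  applies.\<close>

lemma measurable_process_max:
  "(\<lambda>(s, w). X (max 0 s) w) \<in> borel \<Otimes>\<^sub>M W \<rightarrow>\<^sub>M M"
proof -
  have X: "(\<lambda>(t, w). X t w) \<in> measurable (restrict_space borel {0..} \<Otimes>\<^sub>M W) M"
    using process by (simp add: stationary_markov_process_def)
  have "(\<lambda>(s, w). (max 0 s, w)) \<in> borel \<Otimes>\<^sub>M W \<rightarrow>\<^sub>M restrict_space borel {0::real..} \<Otimes>\<^sub>M W"
    unfolding split_beta'
    by (intro measurable_Pair measurable_restrict_space2) (auto simp: space_pair_measure)
  from measurable_compose[OF this X] show ?thesis
    by (simp add: split_beta')
qed

lemma measurable_process: "0 \<le> t \<Longrightarrow> X t \<in> W \<rightarrow>\<^sub>M M"
  using measurable_Pair2[OF measurable_process_max, of t] by simp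

text \<open>The Markov property is integrated over the event that \<open>X s\<close> lies in
  \<open>B\<close>, which belongs to the natural filtration at time \<open>s\<close>. The law of
  \<open>X s\<close> stays explicit because stationarity is derived from the case
  \<open>s = 0\<close>.\<close>

lemma prob_two_times:
  assumes s: "0 \<le> s" and t: "0 \<le> t" and B: "B \<in> sets M" and C: "C \<in> sets M"
  shows "W.prob ((X s -` B \<inter> space W) \<inter> (X (s + t) -` C \<inter> space W))
    = (\<integral>x. indicator B x * measure (P t x) C \<partial>distr W M (X s))"
proof -
  let ?F = "natural_filtration M W X s"
  let ?G = "{X u -` B \<inter> space W | u B. 0 \<le> u \<and> u \<le> s \<and> B \<in> sets M}"
  note [measurable] = measurable_process[OF s] measurable_process[OF add_nonneg_nonneg[OF s t]] B C
  let ?B = "X s -` B \<inter> space W" and ?C = "X (s + t) -` C \<inter> space W"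
  have G: "?G \<subseteq> sets W"
    by (auto intro!: measurable_sets[OF measurable_process])
  then have sp: "?G \<subseteq> Pow (space W)"
    using sets.space_closed by blast
  have "sets ?F = sigma_sets (space W) ?G" "space ?F = space W"
    unfolding natural_filtration_def using sp by (simp_all add: sets_measure_of space_measure_of)
  moreover have "sigma_sets (space W) ?G \<subseteq> sets W"
    using G by (rule sets.sigma_sets_subset)
  ultimately have sub: "subalgebra W ?F"
    by (simp add: subalgebra_def)
  interpret F: finite_measure_subalgebra W ?F
    by unfold_locales (rule sub)
  have BF: "?B \<in> sets ?F"
    unfolding \<open>sets ?F = _\<close> using s B
    by (intro sigma_sets.Basic CollectI exI[of _ s] exI[of _ B]) auto
  have [measurable]: "?B \<in> sets W" "?C \<in> sets W"
    by measurable
  have [measurable]: "(\<lambda>w. measure (P t (X s w)) C) \<in> borel_measurable W"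
    using t by measurable
  have ce: "AE w in W. real_cond_exp W ?F (indicator ?C) w = measure (P t (X s w)) C"
    using process s t C by (simp add: stationary_markov_process_def)
  have "W.prob (?B \<inter> ?C) = (\<integral>w\<in>?B. indicator ?C w \<partial>W)"
    by (simp add: set_lebesgue_integral_def indicator_inter_arith[symmetric])
  also have "\<dots> = (\<integral>w\<in>?B. real_cond_exp W ?F (indicator ?C) w \<partial>W)"
    by (rule F.real_cond_exp_intA) (auto simp: BF W.emeasure_eq_measure)
  also have "\<dots> = (\<integral>w. indicator B (X s w) * measure (P t (X s w)) C \<partial>W)"
    unfolding set_lebesgue_integral_def
    by (rule integral_cong_AE) (use ce AE_space in \<open>auto simp: indicator_def\<close>)
  also have "\<dots> = (\<integral>x. indicator B x * measure (P t x) C \<partial>distr W M (X s))"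
    using t by (subst integral_distr) auto
  finally show ?thesis .
qed

text \<open>With \<open>s = 0\<close> and \<open>B\<close> the whole space, the two-time formula
  gives the law \<open>M \<bind> P t\<close>, which is \<open>M\<close> by invariance.\<close>

lemma distr_process:
  assumes t: "0 \<le> t"
  shows "distr W M (X t) = M"
proof (rule measure_eqI)
  fix C assume "C \<in> sets (distr W M (X t))"
  then have C [measurable]: "C \<in> sets M"
    by simp
  note [measurable] = measurable_process[OF order_refl] measurable_process[OF t]
  have "W.prob (X t -` C \<inter> space W)
      = (\<integral>x. indicator (space M) x * measure (P t x) C \<partial>M)"
    using prob_two_times[OF order_refl t sets.top C] process measurable_space[OF measurable_process[OF order_refl]]
    by (simp add: stationary_markov_process_def vimage_def Int_def)
       (smt (verit) Collect_cong)
  also have "\<dots> = (\<integral>x. measure (P t x) C \<partial>M)"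
    by (intro Bochner_Integration.integral_cong) auto
  also have "\<dots> = measure (M \<bind> P t) C"
    by (rule measure_bind[symmetric, OF kernel[OF t] C])
  also have "\<dots> = prob C"
    by (simp add: bind_kernel[OF t])
  finally show "emeasure (distr W M (X t)) C = emeasure M C"
    using C by (simp add: emeasure_distr emeasure_eq_measure W.emeasure_eq_measure)
qed simp

text \<open>The two laws agree on measurable rectangles, an intersection-stable generator of the
  product sigma-algebra. The kernel attaches the starting point \<open>x\<close> to a sample from
  \<open>P t x\<close>.\<close>

lemma distr_process_pair:
  assumes s: "0 \<le> s" and t: "0 \<le> t"
  shows "distr W (M \<Otimes>\<^sub>M M) (\<lambda>w. (X s w, X (s + t) w)) = M \<bind> (\<lambda>x. distr (P t x) (M \<Otimes>\<^sub>M M) (Pair x))"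
    (is "?D = ?B")
    and kernel_pair: "(\<lambda>x. distr (P t x) (M \<Otimes>\<^sub>M M) (Pair x)) \<in> M \<rightarrow>\<^sub>M subprob_algebra (M \<Otimes>\<^sub>M M)"
proof -
  note [measurable] = measurable_process[OF s] measurable_process[OF add_nonneg_nonneg[OF s t]] kernel[OF t]
  show K: "(\<lambda>x. distr (P t x) (M \<Otimes>\<^sub>M M) (Pair x)) \<in> M \<rightarrow>\<^sub>M subprob_algebra (M \<Otimes>\<^sub>M M)"
    by (rule measurable_distr2) (auto intro!: kernel[OF t])
  let ?E = "{a \<times> b | a b. a \<in> sets M \<and> b \<in> sets M}"
  show "?D = ?B"
  proof (rule measure_eqI_generator_eq[OF Int_stable_pair_measure_generator[of M M]])
    show "?E \<subseteq> Pow (space (M \<Otimes>\<^sub>M M))"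
      using sets.space_closed[of M] by (auto simp: space_pair_measure)
    show "sets ?D = sigma_sets (space (M \<Otimes>\<^sub>M M)) ?E"
      by (simp add: sets_pair_measure space_pair_measure)
    show "sets ?B = sigma_sets (space (M \<Otimes>\<^sub>M M)) ?E"
      using sets_bind[of M "\<lambda>x. distr (P t x) (M \<Otimes>\<^sub>M M) (Pair x)" "M \<Otimes>\<^sub>M M"] not_empty
      by (simp add: sets_pair_measure space_pair_measure)
    show "range (\<lambda>i::nat. space M \<times> space M) \<subseteq> ?E" "(\<Union>i::nat. space M \<times> space M) = space (M \<Otimes>\<^sub>M M)"
      by (auto simp: space_pair_measure)
    show "emeasure ?D (space M \<times> space M) \<noteq> \<infinity>"
      by (simp add: emeasure_distr W.emeasure_eq_measure)
  next
    fix E assume "E \<in> ?E"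
    then obtain B C where E: "E = B \<times> C" and [measurable]: "B \<in> sets M" "C \<in> sets M"
      by auto
    have "emeasure ?D E = emeasure W ((X s -` B \<inter> space W) \<inter> (X (s + t) -` C \<inter> space W))"
      unfolding E by (subst emeasure_distr) (auto intro!: arg_cong[where f = "emeasure W"])
    also have "\<dots> = ennreal (\<integral>x. indicator B x * measure (P t x) C \<partial>M)"
      using prob_two_times[OF s t \<open>B \<in> sets M\<close> \<open>C \<in> sets M\<close>]
      by (simp add: W.emeasure_eq_measure distr_process[OF s])
    also have "\<dots> = (\<integral>\<^sup>+x. ennreal (indicator B x * measure (P t x) C) \<partial>M)"
    proof (rule nn_integral_eq_integral[symmetric])
      show "integrable M (\<lambda>x. indicator B x * measure (P t x) C)"
        by (rule integrable_const_bound[where B = 1])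
           (use prob_space_kernel[OF t] in \<open>auto split: split_indicator intro!: AE_I2 prob_space.prob_le_1\<close>)
    qed auto
    also have "\<dots> = (\<integral>\<^sup>+x. emeasure (distr (P t x) (M \<Otimes>\<^sub>M M) (Pair x)) E \<partial>M)"
    proof (rule nn_integral_cong)
      fix x assume x: "x \<in> space M"
      interpret K: prob_space "P t x"
        by (rule prob_space_kernel[OF t x])
      have [measurable_cong]: "sets (P t x) = sets M"
        by (rule sets_kernel[OF t x])
      have "Pair x -` E \<inter> space (P t x) = (if x \<in> B then C else {})"
        using sets.sets_into_space[OF \<open>C \<in> sets M\<close>] sets_eq_imp_space_eq[OF sets_kernel[OF t x]]
        by (auto simp: E)
      then show "ennreal (indicator B x * measure (P t x) C) = emeasure (distr (P t x) (M \<Otimes>\<^sub>M M) (Pair x)) E"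
        using x by (subst emeasure_distr) (auto simp: E K.emeasure_eq_measure)
    qed
    also have "\<dots> = emeasure ?B E"
      by (rule emeasure_bind[symmetric, OF not_empty K]) (simp add: E)
    finally show "emeasure ?D E = emeasure ?B E" .
  qed
qed

lemma
  fixes f :: "'e \<Rightarrow> real"
  assumes f: "integrable M f" and t: "0 \<le> t"
  shows integrable_process: "integrable W (\<lambda>w. f (X t w))"
    and integral_process: "(\<integral>w. f (X t w) \<partial>W) = (\<integral>x. f x \<partial>M)"
proof -
  have "integrable (distr W M (X t)) f"
    unfolding distr_process[OF t] by (rule f)
  then show "integrable W (\<lambda>w. f (X t w))"
    by (rule integrable_distr[OF measurable_process[OF t]])
  show "(\<integral>w. f (X t w) \<partial>W) = (\<integral>x. f x \<partial>M)"
    using integral_distr[OF measurable_process[OF t] borel_measurable_integrable[OF f]]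
    unfolding distr_process[OF t] by (rule sym)
qed

lemma integrable_process_mult:
  assumes f: "f \<in> L2 M" and g: "g \<in> L2 M" and s: "0 \<le> s" and t: "0 \<le> t"
  shows "integrable W (\<lambda>w. f (X s w) * g (X t w))"
proof (rule L2_integrable_mult)
  show "(\<lambda>w. f (X s w)) \<in> L2 W" "(\<lambda>w. g (X t w)) \<in> L2 W"
    using integrable_process[OF L2_integrable_square[OF f] s] integrable_process[OF L2_integrable_square[OF g] t]
      measurable_compose[OF measurable_process[OF s] L2_measurable[OF f]]
      measurable_compose[OF measurable_process[OF t] L2_measurable[OF g]]
    by (simp_all add: L2_def)
qed

text \<open>Disintegrating the law of the pair over its first coordinate integrates \<open>g\<close>
  against \<open>P t x\<close>, which is the semigroup acting on \<open>g\<close>.\<close>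

lemma expectation_process_mult:
  assumes f: "f \<in> L2 M" and g: "g \<in> L2 M" and s: "0 \<le> s" and t: "0 \<le> t"
  shows "(\<integral>w. f (X s w) * g (X (s + t) w) \<partial>W) = correlation f g t"
proof -
  note [measurable] = measurable_process[OF s] measurable_process[OF add_nonneg_nonneg[OF s t]]
    L2_measurable[OF f] L2_measurable[OF g]
  let ?h = "\<lambda>(x, y). f x * g y"
  let ?K = "\<lambda>x. distr (P t x) (M \<Otimes>\<^sub>M M) (Pair x)"
  have [measurable]: "?h \<in> borel_measurable (M \<Otimes>\<^sub>M M)"
    by measurable
  have "integrable (distr W (M \<Otimes>\<^sub>M M) (\<lambda>w. (X s w, X (s + t) w))) ?h"
    using integrable_process_mult[OF f g s add_nonneg_nonneg[OF s t]]
    by (subst integrable_distr_eq) auto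
  then have int: "integrable (M \<bind> ?K) ?h"
    by (simp add: distr_process_pair[OF s t])
  have "(\<integral>w. f (X s w) * g (X (s + t) w) \<partial>W)
      = integral\<^sup>L (distr W (M \<Otimes>\<^sub>M M) (\<lambda>w. (X s w, X (s + t) w))) ?h"
    by (subst integral_distr) auto
  also have "\<dots> = (\<integral>x. integral\<^sup>L (?K x) ?h \<partial>M)"
    unfolding distr_process_pair[OF s t]
    by (rule integral_bind_integrable[OF kernel_pair[OF t t] not_empty int])
  also have "\<dots> = (\<integral>x. f x * semigroup_op P t g x \<partial>M)"
  proof (rule Bochner_Integration.integral_cong[OF refl])
    fix x assume x: "x \<in> space M"
    have "Pair x \<in> P t x \<rightarrow>\<^sub>M M \<Otimes>\<^sub>M M"
      by (subst measurable_cong_sets[OF sets_kernel[OF t x] refl]) (rule measurable_Pair1'[OF x])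
    then have "integral\<^sup>L (?K x) ?h = (\<integral>y. ?h (x, y) \<partial>P t x)"
      by (rule integral_distr) measurable
    then show "integral\<^sup>L (?K x) ?h = f x * semigroup_op P t g x"
      by (simp add: semigroup_op_def)
  qed
  finally show ?thesis
    by (simp add: correlation_def l2_inner_def)
qed

text \<open>Both factors are the same \<open>h\<close>, so the earlier of the two times can be taken
  first.\<close>

lemma expectation_process_abs_diff:
  assumes h: "h \<in> L2 M" and s: "0 \<le> s" and t: "0 \<le> t"
  shows "(\<integral>w. h (X s w) * h (X t w) \<partial>W) = correlation h h \<bar>s - t\<bar>"
proof (cases "s \<le> t")
  case True
  then show ?thesis
    using expectation_process_mult[OF h h s, of "t - s"] by simp
next
  case False
  then show ?thesis
    using expectation_process_mult[OF h h t, of "s - t"] by (simp add: mult.commute)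
qed

section \<open>Variance of the time integral and its growth rate\<close>

text \<open>The square of the centred time integral is a double time integral of products; Fubini
  moves the expectation inside, where it becomes a correlation.\<close>

lemma variance_time_integral:
  assumes f: "f \<in> L2 M" and h_def: "h = (\<lambda>x. f x - (\<integral>x. f x \<partial>M))" and t: "0 \<le> t"
  shows "W.variance (time_integral X f t)
    = (LINT s:{0..t}|lborel. LINT r:{0..t}|lborel. correlation h h \<bar>s - r\<bar>)"
proof -
  \<comment> \<open>\<open>T\<close> is Lebesgue measure concentrated on \<open>{0..t}\<close>, but
    with the Borel sets of the whole line: time integrals become integrals over a finite measure.
    \<open>Y\<close> is the matching extension of the process to all real times.\<close>
  define T where "T = density lborel (\<lambda>s. ennreal (indicator {0..t} s))"
  define Y where "Y = (\<lambda>s. X (max 0 s))"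
  define m where "m = (\<integral>x. f x \<partial>M)"
  have h: "h \<in> L2 M"
    unfolding h_def by (rule L2_diff[OF f L2_const])
  note [measurable] = L2_measurable[OF f] L2_measurable[OF h]
  have [measurable_cong]: "sets T = sets borel"
    by (simp add: T_def)
  have space_T [simp]: "space T = UNIV"
    by (simp add: T_def)
  have emeasure_T: "emeasure T (space T) = ennreal t"
    unfolding T_def using t by (subst emeasure_density) (auto simp: ennreal_indicator)
  interpret T: finite_measure T
    by (rule finite_measureI) (simp add: emeasure_T[simplified])
  interpret TT: pair_sigma_finite T T ..
  interpret TT: finite_measure "T \<Otimes>\<^sub>M T"
    by (rule finite_measure_pair_measure) unfold_locales
  interpret TW: pair_sigma_finite T W ..
  interpret TTW: pair_sigma_finite "T \<Otimes>\<^sub>M T" W ..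
  have Y_meas: "(\<lambda>(s, w). Y s w) \<in> borel \<Otimes>\<^sub>M W \<rightarrow>\<^sub>M M"
    using measurable_process_max by (simp add: Y_def)
  have Y_comp [measurable]: "(\<lambda>x. Y (a x) (b x)) \<in> N \<rightarrow>\<^sub>M M"
    if [measurable]: "a \<in> borel_measurable N" "b \<in> N \<rightarrow>\<^sub>M W" for a b and N :: "'n measure"
    using measurable_compose[OF measurable_Pair[OF that] Y_meas] by simp
  have integral_T: "(\<integral>s. g s \<partial>T) = (LINT s:{0..t}|lborel. g s)"
    if "g \<in> borel_measurable borel" for g :: "real \<Rightarrow> real"
    unfolding T_def set_lebesgue_integral_def using that by (subst integral_density) auto
  have time_integral_T: "time_integral X g t w = (\<integral>s. g (Y s w) \<partial>T)"
    if [measurable]: "g \<in> borel_measurable M" and "w \<in> space W" for g w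
  proof -
    have [measurable]: "(\<lambda>s. Y s w) \<in> borel \<rightarrow>\<^sub>M M"
      using that(2) by measurable
    have "(\<lambda>s. g (Y s w)) \<in> borel_measurable borel"
      by measurable
    then have "(\<integral>s. g (Y s w) \<partial>T) = (LINT s:{0..t}|lborel. g (Y s w))"
      by (rule integral_T)
    also have "\<dots> = time_integral X g t w"
      unfolding time_integral_def by (intro set_lebesgue_integral_cong) (auto simp: Y_def)
    finally show ?thesis ..
  qed
  have int_TW: "integrable (T \<Otimes>\<^sub>M W) (\<lambda>(s, w). g (Y s w))" if g: "integrable M g" for g :: "'e \<Rightarrow> real"
  proof (rule TW.Fubini_integrable)
    note [measurable] = borel_measurable_integrable[OF g]
    show "(\<lambda>(s, w). g (Y s w)) \<in> borel_measurable (T \<Otimes>\<^sub>M W)"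
      by measurable
    show "AE s in T. integrable W (\<lambda>w. (\<lambda>(s, w). g (Y s w)) (s, w))"
      using integrable_process[OF g] by (simp add: Y_def)
    show "integrable T (\<lambda>s. \<integral>w. norm ((\<lambda>(s, w). g (Y s w)) (s, w)) \<partial>W)"
      using integral_process[OF integrable_norm[OF g]] by (simp add: Y_def)
  qed
  note int_h = int_TW[OF L2_integrable[OF h]]
  have AE_h: "AE w in W. integrable T (\<lambda>s. h (Y s w))"
    using TW.AE_integrable_snd[of "\<lambda>s w. h (Y s w)"] int_h by simp
  \<comment> \<open>\<open>Z\<close> is the centred time integral; its mean is 0, so the variance
    will be the expectation of its square.\<close>
  define Z where "Z = (\<lambda>w. \<integral>s. h (Y s w) \<partial>T)"
  have int_Z: "integrable W Z" and EZ: "(\<integral>w. Z w \<partial>W) = 0"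
  proof -
    show "integrable W Z"
      unfolding Z_def using TW.integrable_snd[of "\<lambda>s w. h (Y s w)"] int_h by simp
    have "(\<integral>w. Z w \<partial>W) = (\<integral>s. \<integral>w. h (Y s w) \<partial>W \<partial>T)"
      unfolding Z_def by (rule TW.Fubini_integral) (use int_h in simp)
    also have "\<dots> = (\<integral>s. (\<integral>x. h x \<partial>M) \<partial>T)"
      using integral_process[OF L2_integrable[OF h]] by (simp add: Y_def)
    also have "(\<integral>x. h x \<partial>M) = 0"
      unfolding h_def by (simp add: L2_integrable[OF f] prob_space)
    finally show "(\<integral>w. Z w \<partial>W) = 0"
      by simp
  qed
  have [measurable]: "time_integral X f t \<in> borel_measurable W"
    by (subst measurable_cong[OF time_integral_T]) measurable
  \<comment> \<open>Splitting off the mean requires \<open>h\<close> to be integrable along the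
    path, which holds for almost every \<open>w\<close>.\<close>
  have AE_time: "AE w in W. time_integral X f t w = Z w + t * m"
    using AE_h AE_space
  proof eventually_elim
    case (elim w)
    have "time_integral X f t w = (\<integral>s. h (Y s w) + m \<partial>T)"
      using elim by (subst time_integral_T) (simp_all add: h_def m_def)
    also have "\<dots> = Z w + t * m"
      using elim emeasure_T t by (simp add: Z_def measure_def)
    finally show ?case .
  qed
  have "(\<integral>w. time_integral X f t w \<partial>W) = (\<integral>w. Z w + t * m \<partial>W)"
    using AE_time int_Z by (intro integral_cong_AE) auto
  also have "\<dots> = t * m"
    using int_Z by (simp add: EZ W.prob_space)
  finally have E_time: "(\<integral>w. time_integral X f t w \<partial>W) = t * m" .
  have H: "integrable ((T \<Otimes>\<^sub>M T) \<Otimes>\<^sub>M W) (\<lambda>(x, w). h (Y (fst x) w) * h (Y (snd x) w))"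
  proof (rule TTW.Fubini_integrable)
    show "(\<lambda>(x, w). h (Y (fst x) w) * h (Y (snd x) w)) \<in> borel_measurable ((T \<Otimes>\<^sub>M T) \<Otimes>\<^sub>M W)"
      by measurable
    show "AE x in T \<Otimes>\<^sub>M T. integrable W (\<lambda>w. (\<lambda>(x, w). h (Y (fst x) w) * h (Y (snd x) w)) (x, w))"
      using integrable_process_mult[OF h h] by (simp add: Y_def)
    \<comment> \<open>Applying the correlation bound to the absolute value of \<open>h\<close>
      dominates the expected absolute product by a constant, which suffices on the finite measure
      \<open>T \<Otimes>\<^sub>M T\<close>.\<close>
    have abs_h: "(\<lambda>x. \<bar>h x\<bar>) \<in> L2 M"
      using h by (simp add: L2_def)
    show "integrable (T \<Otimes>\<^sub>M T)
        (\<lambda>x. \<integral>w. norm ((\<lambda>(x, w). h (Y (fst x) w) * h (Y (snd x) w)) (x, w)) \<partial>W)"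
    proof (rule TT.integrable_const_bound)
      show "AE x in T \<Otimes>\<^sub>M T.
          norm (\<integral>w. norm ((\<lambda>(x, w). h (Y (fst x) w) * h (Y (snd x) w)) (x, w)) \<partial>W)
            \<le> l2_norm M (\<lambda>x. \<bar>h x\<bar>) * l2_norm M (\<lambda>x. \<bar>h x\<bar>)"
        using expectation_process_abs_diff[OF abs_h] correlation_le[OF _ abs_h abs_h]
        by (simp add: Y_def abs_mult)
      show "(\<lambda>x. \<integral>w. norm ((\<lambda>(x, w). h (Y (fst x) w) * h (Y (snd x) w)) (x, w)) \<partial>W)
          \<in> borel_measurable (T \<Otimes>\<^sub>M T)"
        by measurable
    qed
  qed
  \<comment> \<open>\<open>q\<close> is measurable in all pairs of real times; it is replaced by the
    correlation only at the end, where both times are nonnegative.\<close>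
  define q where "q = (\<lambda>s r. \<integral>w. h (Y s w) * h (Y r w) \<partial>W)"
  have q_eq: "q s r = correlation h h \<bar>s - r\<bar>" if "0 \<le> s" "0 \<le> r" for s r
    using expectation_process_abs_diff[OF h that] that by (simp add: q_def Y_def)
  have [measurable]: "(\<lambda>x. q (a x) (b x)) \<in> borel_measurable N"
    if [measurable]: "a \<in> borel_measurable N" "b \<in> borel_measurable N" for a b and N :: "'n measure"
    unfolding q_def by measurable
  have int_q: "integrable (T \<Otimes>\<^sub>M T) (\<lambda>x. q (fst x) (snd x))"
    unfolding q_def using TTW.integrable_fst'[OF H] by simp
  have "W.variance (time_integral X f t) = (\<integral>w. (Z w)\<^sup>2 \<partial>W)"
    unfolding E_time using int_Z AE_time
    by (intro integral_cong_AE) auto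
  also have "\<dots> = (\<integral>w. \<integral>x. h (Y (fst x) w) * h (Y (snd x) w) \<partial>(T \<Otimes>\<^sub>M T) \<partial>W)"
  proof (rule integral_cong_AE)
    have "AE w in W. integrable (T \<Otimes>\<^sub>M T) (\<lambda>x. h (Y (fst x) w) * h (Y (snd x) w))"
      by (rule TTW.AE_integrable_snd) (use H in \<open>simp add: split_beta'\<close>)
    then show "AE w in W. (Z w)\<^sup>2 = (\<integral>x. h (Y (fst x) w) * h (Y (snd x) w) \<partial>(T \<Otimes>\<^sub>M T))"
      by eventually_elim (simp add: TT.integral_fst'[symmetric] Z_def power2_eq_square)
  qed (use int_Z in auto)
  also have "\<dots> = (\<integral>x. \<integral>w. h (Y (fst x) w) * h (Y (snd x) w) \<partial>W \<partial>(T \<Otimes>\<^sub>M T))"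
    by (rule TTW.Fubini_integral) (use H in \<open>simp add: split_beta'\<close>)
  also have "\<dots> = (\<integral>x. q (fst x) (snd x) \<partial>(T \<Otimes>\<^sub>M T))"
    by (simp add: q_def)
  also have "\<dots> = (\<integral>s. \<integral>r. q s r \<partial>T \<partial>T)"
    using int_q by (simp add: TT.integral_fst'[symmetric])
  also have "\<dots> = (LINT s:{0..t}|lborel. \<integral>r. q s r \<partial>T)"
    by (rule integral_T) measurable
  also have "\<dots> = (LINT s:{0..t}|lborel. LINT r:{0..t}|lborel. q s r)"
    by (simp add: integral_T)
  also have "\<dots> = (LINT s:{0..t}|lborel. LINT r:{0..t}|lborel. correlation h h \<bar>s - r\<bar>)"
    by (intro set_lebesgue_integral_cong allI impI) (auto simp: q_eq)
  finally show ?thesis .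
qed

lemma asymptotic_variance:
  assumes f: "f \<in> L2 M" and h_def: "h = (\<lambda>x. f x - (\<integral>x. f x \<partial>M))"
    and u: "(u, \<lambda>x. - h x) \<in> generator M P" and w: "(w, \<lambda>x. - u x) \<in> generator M P"
  shows "has_asymptotic_variance W X f (2 * l2_inner M h u)"
proof -
  have h: "h \<in> L2 M"
    unfolding h_def by (rule L2_diff[OF f L2_const])
  have uL2: "u \<in> L2 M" and wL2: "w \<in> L2 M"
    using u w by (simp_all add: generator_def)
  \<comment> \<open>Since \<open>u\<close> is mapped to \<open>- h\<close> and \<open>w\<close> to
    \<open>- u\<close>, the derivatives of \<open>correlation h u\<close> and
    \<open>correlation h w\<close> carry a minus sign. The constants are chosen so that
    \<open>C\<close> and \<open>D\<close> vanish at 0.\<close>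
  define C where "C = (\<lambda>t. l2_inner M h u - correlation h u t)"
  define D where "D = (\<lambda>t. l2_inner M h u * t - (l2_inner M h w - correlation h w t))"
  have "(C has_real_derivative correlation h h x) (at x within {0..})" if "0 \<le> x" for x
    unfolding C_def
    using DERIV_diff[OF DERIV_const correlation_has_derivative[OF h u that]]
    by (simp add: correlation_uminus)
  moreover have "(D has_real_derivative C x) (at x within {0..})" if "0 \<le> x" for x
    unfolding D_def C_def using correlation_has_derivative[OF h w that]
    by (auto intro!: derivative_eq_intros simp: correlation_uminus)
  ultimately have var: "W.variance (time_integral X f t) = 2 * D t" if "0 \<le> t" for t
    using double_integral_abs_diff[of "correlation h h" C D t] that
    by (simp add: variance_time_integral[OF f h_def that] continuous_on_correlation[OF h h]
        C_def D_def correlation_0 h uL2 wL2)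
  \<comment> \<open>Contraction makes \<open>b\<close> a bound on the non-linear part of
    \<open>D\<close>, uniform in time, so this part disappears after division by
    \<open>t\<close>.\<close>
  define b where "b = \<bar>l2_inner M h w\<bar> + l2_norm M h * l2_norm M w"
  have "((\<lambda>t. b / t) \<longlongrightarrow> 0) at_top"
    by (intro tendsto_divide_0[OF tendsto_const] filterlim_at_top_imp_at_infinity filterlim_ident)
  then have "((\<lambda>t. (l2_inner M h w - correlation h w t) / t) \<longlongrightarrow> 0) at_top"
  proof (rule Lim_null_comparison[rotated])
    show "\<forall>\<^sub>F t in at_top. norm ((l2_inner M h w - correlation h w t) / t) \<le> b / t"
      using eventually_gt_at_top[of 0]
    proof eventually_elim
      case (elim t)
      have "\<bar>l2_inner M h w - correlation h w t\<bar> \<le> b"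
        using correlation_le[OF less_imp_le[OF elim] h wL2] unfolding b_def by linarith
      then show ?case
        using elim by (simp add: divide_right_mono)
    qed
  qed
  then have "((\<lambda>t. 2 * (l2_inner M h u - (l2_inner M h w - correlation h w t) / t))
      \<longlongrightarrow> 2 * (l2_inner M h u - 0)) at_top"
    by (intro tendsto_intros)
  moreover have "\<forall>\<^sub>F t in at_top. 2 * (l2_inner M h u - (l2_inner M h w - correlation h w t) / t)
      = W.variance (time_integral X f t) / t"
    using eventually_gt_at_top[of 0]
    by eventually_elim (simp add: var D_def diff_divide_distrib)
  ultimately have "((\<lambda>t. W.variance (time_integral X f t) / t) \<longlongrightarrow> 2 * (l2_inner M h u - 0)) at_top"
    by (rule Lim_transform_eventually)
  then show ?thesis
    by (simp add: has_asymptotic_variance_def)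
qed

end

section \<open>Comparison of the asymptotic variances\<close>

lemma linear_operator_subset: "linear_operator M V T \<Longrightarrow> T \<subseteq> V \<times> V"
  by (simp add: linear_operator_def)

lemma self_adjoint_subset: "self_adjoint M V T \<Longrightarrow> T \<subseteq> V \<times> V"
  unfolding self_adjoint_def by (blast dest: linear_operator_subset)

lemma boundedly_invertible_mean_zeroE:
  assumes "boundedly_invertible M (mean_zero M) (op_restrict (mean_zero M) T)" and "g \<in> mean_zero M"
  obtains u where "u \<in> mean_zero M" "(u, g) \<in> T"
  using assms unfolding boundedly_invertible_def op_restrict_def by blast

text \<open>With \<open>T u\<^sub>0 = g = (T + S + A) u\<close>, dissipativity of \<open>T\<close> is applied to \<open>u - u\<^sub>0\<close>; the cross terms
  are evaluated by the symmetry of \<open>T\<close>, and \<open>\<langle>u, A u\<rangle> = 0\<close>.\<close>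

lemma inverse_form_perturbation_le:
  assumes T: "self_adjoint M (L2 M) T" and T_nonpos: "\<And>f g. (f, g) \<in> T \<Longrightarrow> l2_inner M f g \<le> 0"
    and S: "S \<subseteq> L2 M \<times> L2 M" and S_nonpos: "\<forall>(f, Sf)\<in>S. l2_inner M f Sf \<le> 0"
    and A: "A \<subseteq> L2 M \<times> L2 M"
    and A_skew: "\<forall>(f, Af)\<in>A. \<forall>(g, Ag)\<in>A. l2_inner M f Ag = - l2_inner M Af g"
    and u: "(u, g) \<in> op_sum (op_sum T S) A" and u0: "(u0, g) \<in> T"
  shows "l2_inner M g u0 \<le> l2_inner M g u"
proof -
  obtain l s a where g: "g = (\<lambda>x. (l x + s x) + a x)"
    and l: "(u, l) \<in> T" and s: "(u, s) \<in> S" and a: "(u, a) \<in> A"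
    using u unfolding op_sum_def by blast
  have lin: "linear_operator M (L2 M) T" and adj: "op_adjoint M (L2 M) T = T"
    using T by (simp_all add: self_adjoint_def)
  have TL2: "T \<subseteq> L2 M \<times> L2 M"
    using T by (rule self_adjoint_subset)
  have L2s: "u \<in> L2 M" "l \<in> L2 M" "u0 \<in> L2 M" "g \<in> L2 M" "s \<in> L2 M" "a \<in> L2 M"
    using l s a u0 S A TL2 by auto
  \<comment> \<open>Skew-symmetry is tested on the pair \<open>(u, a)\<close> against
    itself.\<close>
  have "l2_inner M u a = - l2_inner M a u"
    using A_skew a by blast
  then have ua: "l2_inner M u a = 0"
    by (simp add: l2_inner_commute)
  have us: "l2_inner M u s \<le> 0"
    using S_nonpos s by blast
  have "l2_inner M u g = l2_inner M u l + l2_inner M u s + l2_inner M u a"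
    using l2_inner_lincomb[of u M "\<lambda>x. l x + s x" a 1 1] l2_inner_lincomb[of u M l s 1 1]
      L2_lincomb[of l M s 1 1] L2s by (simp add: g)
  then have ug: "l2_inner M u g \<le> l2_inner M u l"
    using ua us by simp
  \<comment> \<open>Membership in the adjoint, tested on \<open>(u0, g)\<close>, is the symmetry of
    \<open>T\<close> between \<open>u\<close> and \<open>u0\<close>.\<close>
  have "(u, l) \<in> op_adjoint M (L2 M) T"
    using l adj by simp
  then have sym: "l2_inner M g u = l2_inner M u0 l"
    using u0 unfolding op_adjoint_def by blast
  have "((\<lambda>x. (- 1) * u0 x), (\<lambda>x. (- 1) * g x)) \<in> T"
    using lin u0 unfolding linear_operator_def by blast
  with l have "((\<lambda>x. u x + (- 1) * u0 x), (\<lambda>x. l x + (- 1) * g x)) \<in> T"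
    using lin unfolding linear_operator_def by blast
  then have "l2_inner M (\<lambda>x. u x - u0 x) (\<lambda>x. l x - g x) \<le> 0"
    using T_nonpos by fastforce
  also have "l2_inner M (\<lambda>x. u x - u0 x) (\<lambda>x. l x - g x)
      = l2_inner M u l - l2_inner M u g - l2_inner M u0 l + l2_inner M u0 g"
    using L2s by (simp add: l2_inner_diff l2_inner_diff_left L2_diff)
  \<comment> \<open>By \<open>sym\<close> the expansion reads \<open>\<langle>u, l\<rangle> - 2
    \<langle>u, g\<rangle> + \<langle>u0, g\<rangle> \<le> 0\<close>, and \<open>ug\<close> bounds
    \<open>\<langle>u, l\<rangle>\<close> below by \<open>\<langle>u, g\<rangle>\<close>.\<close>
  finally show ?thesis
    using ug sym l2_inner_commute[of M g u] l2_inner_commute[of M g u0] by simp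
qed

text \<open>The asymptotic variances are asserted as existing limits; uniqueness of limits makes the
  witnesses \<open>v\<close> and \<open>v0\<close> the variances themselves.\<close>

theorem lemma2:
  fixes \<pi> :: "'e measure"
    and P0 P1 P :: "real \<Rightarrow> 'e \<Rightarrow> 'e measure"
    and W0 :: "'w0 measure" and X0 :: "real \<Rightarrow> 'w0 \<Rightarrow> 'e"
    and W1 :: "'w1 measure" and X1 :: "real \<Rightarrow> 'w1 \<Rightarrow> 'e"
    and W :: "'w measure" and X :: "real \<Rightarrow> 'w \<Rightarrow> 'e"
    and L0 S A L :: "'e l2_op"
  assumes "prob_space \<pi>"
    \<comment> \<open>reference process\<close>
    and "stationary_markov_process \<pi> P0 W0 X0"
    and "ergodic \<pi> P0"
    and "time_reversible \<pi> P0"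
    and "L0 = generator \<pi> P0"
    and "self_adjoint \<pi> (L2 \<pi>) L0"
    and "\<exists>c<0. op_spectrum \<pi> (L2 \<pi>) L0 - {0} \<subseteq> {..c}"
    \<comment> \<open>reversible perturbation\<close>
    and "Domain L0 \<subseteq> Domain S"
    and "stationary_markov_process \<pi> P1 W1 X1"
    and "op_sum L0 S = generator \<pi> P1"
    and "self_adjoint \<pi> (L2 \<pi>) (op_sum L0 S)"
    and "self_adjoint \<pi> (L2 \<pi>) S"
    and "\<forall>(f, Sf)\<in>S. l2_inner \<pi> f Sf \<le> 0"
    \<comment> \<open>irreversible perturbation\<close>
    and "linear_operator \<pi> (L2 \<pi>) A"
    and "Domain (op_sum L0 S) \<subseteq> Domain A"
    and "L = op_sum (op_sum L0 S) A"
    and "stationary_markov_process \<pi> P W X"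
    and "L = generator \<pi> P"
    and "\<forall>(f, Af)\<in>A. \<forall>(g, Ag)\<in>A. l2_inner \<pi> f Ag = - l2_inner \<pi> Af g"
    \<comment> \<open>invertibility on the mean-zero functions\<close>
    and "boundedly_invertible \<pi> (mean_zero \<pi>) (op_restrict (mean_zero \<pi>) L0)"
    and "boundedly_invertible \<pi> (mean_zero \<pi>) (op_restrict (mean_zero \<pi>) L)"
    \<comment> \<open>boundedness of the sandwiched irreversible perturbation\<close>
    and "op_bounded \<pi>
          (op_inv_sqrt \<pi> (mean_zero \<pi>) (op_restrict (mean_zero \<pi>) (op_neg (op_sum L0 S))) O A O
           op_inv_sqrt \<pi> (mean_zero \<pi>) (op_restrict (mean_zero \<pi>) (op_neg (op_sum L0 S))))"
  shows "\<forall>f\<in>L2 \<pi>. \<exists>v v0. has_asymptotic_variance W X f v \<and> has_asymptotic_variance W0 X0 f v0 \<and> v \<le> v0"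
proof
  fix f assume f: "f \<in> L2 \<pi>"
  define h where "h = (\<lambda>x. f x - (\<integral>x. f x \<partial>\<pi>))"
  interpret Pi: prob_space \<pi>
    by (rule assms(1))
  have W: "prob_space W" "prob_space W0"
    using assms(2,17) by (simp_all add: stationary_markov_process_def)
  interpret X: stationary_process \<pi> W P X
    using W assms(1,17) by (simp add: stationary_process_def stationary_process_axioms_def)
  interpret X0: stationary_process \<pi> W0 P0 X0
    using W assms(1,2) by (simp add: stationary_process_def stationary_process_axioms_def)
  have uminus_mean_zero: "(\<lambda>x. - g x) \<in> mean_zero \<pi>" if "g \<in> mean_zero \<pi>" for g
    using that by (simp add: mean_zero_def L2_uminus)
  have "(\<integral>x. h x \<partial>\<pi>) = 0"
    unfolding h_def by (simp add: X.L2_integrable[OF f] Pi.prob_space)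
  then have "h \<in> mean_zero \<pi>"
    using L2_diff[OF f X.L2_const] by (simp add: mean_zero_def h_def)
  \<comment> \<open>The fact \<open>h\<close> concerns the negative of the function
    \<open>h\<close>, because the equations solved next have right-hand side
    \<open>- h\<close>.\<close>
  note h = uminus_mean_zero[OF this]
  obtain u where u: "u \<in> mean_zero \<pi>" "(u, \<lambda>x. - h x) \<in> L"
    using boundedly_invertible_mean_zeroE[OF assms(21) h] .
  \<comment> \<open>A second inversion is possible because the first solution \<open>u\<close> is
    again mean-zero; it supplies the second antiderivative of the covariance.\<close>
  obtain w where w: "(w, \<lambda>x. - u x) \<in> L"
    using boundedly_invertible_mean_zeroE[OF assms(21) uminus_mean_zero[OF u(1)]] .
  obtain u0 where u0: "u0 \<in> mean_zero \<pi>" "(u0, \<lambda>x. - h x) \<in> L0"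
    using boundedly_invertible_mean_zeroE[OF assms(20) h] .
  obtain w0 where w0: "(w0, \<lambda>x. - u0 x) \<in> L0"
    using boundedly_invertible_mean_zeroE[OF assms(20) uminus_mean_zero[OF u0(1)]] .
  have "has_asymptotic_variance W X f (2 * l2_inner \<pi> h u)"
    by (rule X.asymptotic_variance[OF f h_def]) (rule u(2)[unfolded assms(18)] w[unfolded assms(18)])+
  moreover have "has_asymptotic_variance W0 X0 f (2 * l2_inner \<pi> h u0)"
    by (rule X0.asymptotic_variance[OF f h_def]) (rule u0(2)[unfolded assms(5)] w0[unfolded assms(5)])+
  \<comment> \<open>The comparison is applied with \<open>g\<close> equal to \<open>- h\<close>,
    since it is phrased for the generators rather than their negatives; removing the sign afterwards
    reverses the inequality.\<close>
  moreover have "l2_inner \<pi> (\<lambda>x. - h x) u0 \<le> l2_inner \<pi> (\<lambda>x. - h x) u"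
  proof (rule inverse_form_perturbation_le[OF assms(6) _ _ assms(13) _ assms(19) _ u0(2)])
    show "l2_inner \<pi> f g \<le> 0" if "(f, g) \<in> L0" for f g
      by (rule X0.generator_nonpos) (rule that[unfolded assms(5)])
    show "S \<subseteq> L2 \<pi> \<times> L2 \<pi>"
      by (rule self_adjoint_subset[OF assms(12)])
    show "A \<subseteq> L2 \<pi> \<times> L2 \<pi>"
      by (rule linear_operator_subset[OF assms(14)])
    show "(u, \<lambda>x. - h x) \<in> op_sum (op_sum L0 S) A"
      unfolding assms(16)[symmetric] by (rule u(2))
  qed
  then have "l2_inner \<pi> h u \<le> l2_inner \<pi> h u0"
    by (simp add: l2_inner_commute[of \<pi> "\<lambda>x. - h x"] l2_inner_uminus l2_inner_commute[of \<pi> h])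
  ultimately show "\<exists>v v0. has_asymptotic_variance W X f v \<and> has_asymptotic_variance W0 X0 f v0 \<and> v \<le> v0"
    by (intro exI[of _ "2 * l2_inner \<pi> h u"] exI[of _ "2 * l2_inner \<pi> h u0"]) simp
qed

end
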